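(* Let $\Psi$ be the set of test functions defined below. No proper closed subset $C$ of $\Psi$ is a set of test functions for $H^\infty_1(\mathbb{D})$; that is, for every proper closed subset $C\subsetneq\Psi$ it is not the case that $H^\infty(\mathcal{K}_C)=H^\infty_1(\mathbb{D})$ with $\|\cdot\|_{H^\infty(\mathcal{K}_C)}=\|\cdot\|_\infty$.
   Context: $\widehat{\Theta}$ is the set of probability measures on the unit circle $\mathbb{T}$ of the following two kinds: (i) $\frac12(\delta_a+\delta_{-a})$ with $a\in\mathbb{T}$; (ii) $\lambda_1\delta_{w_1}+\lambda_2\delta_{w_2}+\lambda_3\delta_{w_3}$ with $w_1,w_2,w_3\in\mathbb{T}$ distinct, $0$ in the interior of the triangle with vertices $w_1,w_2,w_3$, and $(\lambda_1,\lambda_2,\lambda_3)$ the barycentric coordinates of $0$ with respect to these vertices. For $\vartheta\in\widehat\Theta$, $h_\vartheta(z)=\int_{\mathbb{T}}\frac{w+z}{w-z}\,d\vartheta(w)$ and $\psi_\vartheta=\frac{h_\vartheta-1}{h_\vartheta+1}$ (a Blaschke product of degree 2 or 3 with $\psi_\vartheta(0)=\psi_\vartheta'(0)=0$). $\Psi=\{\overline{\psi_\vartheta(-1)}\,\psi_\vartheta:\vartheta\in\widehat\Theta\}$, i.e. the functions $z^2$ and $\lambda z^2\frac{z-a}{1-\overline{a}z}$ ($0<|a|<1$ or $a=0$, $\lambda$ unimodular chosen so the value at $-1$ is $1$); $\Psi$ is topologised as the quotient of $\widehat\Theta$ (weak-* topology) under $\vartheta\mapsto\overline{\psi_\vartheta(-1)}\psi_\vartheta$.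 $H^\infty_1(\mathbb{D})=\{g\in H^\infty(\mathbb{D}):g'(0)=0\}$ with the supremum norm. For a set $C$ of functions on $\mathbb{D}$, $\mathcal{K}_C$ is the set of positive semidefinite kernels $k$ on $\mathbb{D}\times\mathbb{D}$ such that $(1-\psi(x)\overline{\psi(y)})k(x,y)$ is positive semidefinite for every $\psi\in C$; $f$ lies in the closed unit ball of $H^\infty(\mathcal{K}_C)$ iff $(1-f(x)\overline{f(y)})k(x,y)$ is positive semidefinite for all $k\in\mathcal{K}_C$, and $H^\infty(\mathcal{K}_C)$ consists of scalar multiples of such functions with the associated Minkowski norm. *)

theory Defs
  imports "HOL-Analysis.Analysis"
begin

text \<open>Finitely supported (atomic) measures on the unit circle are represented by their
  weight functions \<open>\<mu> :: complex \<Rightarrow> real\<close>; \<open>\<mu> w\<close> is the mass of the atom at \<open>w\<close>.\<close>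

definition msupp :: "(complex \<Rightarrow> real) \<Rightarrow> complex set" where
  "msupp \<mu> = {w. \<mu> w \<noteq> 0}"

definition mint :: "(complex \<Rightarrow> real) \<Rightarrow> (complex \<Rightarrow> complex) \<Rightarrow> complex" where
  "mint \<mu> f = (\<Sum>w\<in>msupp \<mu>. complex_of_real (\<mu> w) * f w)"

definition theta_hat :: "(complex \<Rightarrow> real) set" where
  "theta_hat =
     {\<mu>. (\<exists>a. cmod a = 1 \<and> \<mu> = (\<lambda>w. if w = a \<or> w = -a then 1/2 else 0))
        \<or> (\<exists>w1 w2 w3 l1 l2 l3.
             cmod w1 = 1 \<and> cmod w2 = 1 \<and> cmod w3 = 1 \<and>
             w1 \<noteq> w2 \<and> w1 \<noteq> w3 \<and> w2 \<noteq> w3 \<and>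
             0 \<in> interior (convex hull {w1, w2, w3}) \<and>
             l1 + l2 + l3 = 1 \<and>
             of_real l1 * w1 + of_real l2 * w2 + of_real l3 * w3 = 0 \<and>
             \<mu> = (\<lambda>w. if w = w1 then l1 else if w = w2 then l2 else if w = w3 then l3 else 0))}"

definition weak_star_theta :: "(complex \<Rightarrow> real) topology" where
  "weak_star_theta = topology_generated_by
     {{\<mu> \<in> theta_hat. mint \<mu> f \<in> U} | f U. continuous_on (sphere 0 1) f \<and> open U}"

definition herglotz :: "(complex \<Rightarrow> real) \<Rightarrow> complex \<Rightarrow> complex" where
  "herglotz \<mu> z = mint \<mu> (\<lambda>w. (w + z) / (w - z))"

definition psi_theta :: "(complex \<Rightarrow> real) \<Rightarrow> complex \<Rightarrow> complex" where
  "psi_theta \<mu> z = (herglotz \<mu> z - 1) / (herglotz \<mu> z + 1)"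

text \<open>Value at -1 of the Blaschke product (continuous extension from the disc).\<close>
definition psi_at_m1 :: "(complex \<Rightarrow> real) \<Rightarrow> complex" where
  "psi_at_m1 \<mu> = Lim (at (-1) within ball 0 1) (psi_theta \<mu>)"

definition Phi :: "(complex \<Rightarrow> real) \<Rightarrow> complex \<Rightarrow> complex" where
  "Phi \<mu> = (\<lambda>z. if z \<in> ball 0 1 then cnj (psi_at_m1 \<mu>) * psi_theta \<mu> z else 0)"

definition Psi :: "(complex \<Rightarrow> complex) set" where
  "Psi = Phi ` theta_hat"

text \<open>Closed subsets of Psi in the quotient topology.\<close>
definition closed_in_Psi :: "(complex \<Rightarrow> complex) set \<Rightarrow> bool" where
  "closed_in_Psi C \<longleftrightarrow> C \<subseteq> Psi \<and> closedin weak_star_theta {\<mu> \<in> theta_hat. Phi \<mu> \<in> C}"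

definition psd_kernel :: "(complex \<Rightarrow> complex \<Rightarrow> complex) \<Rightarrow> bool" where
  "psd_kernel k \<longleftrightarrow>
     (\<forall>(n::nat) (x::nat \<Rightarrow> complex) (c::nat \<Rightarrow> complex). (\<forall>i<n. x i \<in> ball 0 1) \<longrightarrow>
        (let s = (\<Sum>i<n. \<Sum>j<n. c i * cnj (c j) * k (x i) (x j)) in Im s = 0 \<and> Re s \<ge> 0))"

definition K_set :: "(complex \<Rightarrow> complex) set \<Rightarrow> (complex \<Rightarrow> complex \<Rightarrow> complex) set" where
  "K_set C = {k. psd_kernel k \<and>
               (\<forall>\<psi>\<in>C. psd_kernel (\<lambda>x y. (1 - \<psi> x * cnj (\<psi> y)) * k x y))}"

definition Hinf_K_ball :: "(complex \<Rightarrow> complex) set \<Rightarrow> (complex \<Rightarrow> complex) \<Rightarrow> bool" where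
  "Hinf_K_ball C f \<longleftrightarrow>
     (\<forall>k\<in>K_set C. psd_kernel (\<lambda>x y. (1 - f x * cnj (f y)) * k x y))"

definition Hinf_K :: "(complex \<Rightarrow> complex) set \<Rightarrow> (complex \<Rightarrow> complex) \<Rightarrow> bool" where
  "Hinf_K C f \<longleftrightarrow> (\<exists>c g. Hinf_K_ball C g \<and> (\<forall>z\<in>ball 0 1. f z = c * g z))"

definition Hinf_K_norm :: "(complex \<Rightarrow> complex) set \<Rightarrow> (complex \<Rightarrow> complex) \<Rightarrow> real" where
  "Hinf_K_norm C f = Inf {t. t > 0 \<and> Hinf_K_ball C (\<lambda>z. f z / of_real t)}"

definition Hinf1 :: "(complex \<Rightarrow> complex) \<Rightarrow> bool" where
  "Hinf1 f \<longleftrightarrow> f holomorphic_on ball 0 1 \<and> bounded (f ` ball 0 1) \<and> deriv f 0 = 0"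

definition sup_norm :: "(complex \<Rightarrow> complex) \<Rightarrow> real" where
  "sup_norm f = Sup ((\<lambda>z. cmod (f z)) ` ball 0 1)"

definition test_functions_for_Hinf1 :: "(complex \<Rightarrow> complex) set \<Rightarrow> bool" where
  "test_functions_for_Hinf1 C \<longleftrightarrow>
     (\<forall>f. (Hinf_K C f \<longleftrightarrow> Hinf1 f) \<and> (Hinf1 f \<longrightarrow> Hinf_K_norm C f = sup_norm f))"

end

theory Submission
  imports Defs
begin

text \<open>
  A measure in \<open>theta_hat\<close> with atoms \<open>w1, w2, w3\<close> gives, up to a unimodular constant, the function
  \<open>g_b z = z\<^sup>2 (z - b) / (1 - cnj b z)\<close> with \<open>b = w1 + w2 + w3\<close>, where \<open>|b| \<le> 1\<close> and \<open>|b| = 1\<close>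
  means \<open>z\<^sup>2\<close>. Weak-* closedness of the preimage of \<open>C\<close> and compactness of the set of (atoms, weights) turn
  \<open>C\<close> into a compact set \<open>K\<close> of parameters \<open>b\<close>, missing the parameter \<open>a\<close> of some omitted \<open>g_a\<close>.

  It suffices to find a kernel \<open>k\<close> in \<open>K_set C\<close> for which \<open>(1 - g_a g_a*) k\<close> is not positive
  semidefinite, because then the norm of \<open>g_a\<close> exceeds \<open>1\<close>. The kernel may be supported on four points.
  On these points the Szego kernel, compressed to the direction orthogonal to the model space of \<open>g_a\<close>,
  gives a nonnegative form on the terms \<open>(1 - g_b g_b*) v v*\<close>. For \<open>|b| < 1\<close> it vanishes only if \<open>v\<close> is
  proportional to \<open>(1 - cnj b x) / (1 - cnj a x)\<close>, and there a second form takes the value \<open>|a - b|\<^sup>2\<close>,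
  which is positive for \<open>b \<noteq> a\<close>, while both forms vanish on \<open>1 - g_a g_a*\<close>. By compactness of \<open>K\<close> a large
  multiple of the first form plus the second is bounded below by a positive constant, which leaves room
  for the small perturbation that makes the value at \<open>1 - g_a g_a*\<close> negative.
\<close>

section \<open>Degree three Blaschke products with a double zero at the origin\<close>

text \<open>For \<open>cmod b = 1\<close> this degenerates on the disc to \<open>- b * z\<^sup>2\<close>, so both kinds of test functions are covered.\<close>
definition blaschke2 :: "complex \<Rightarrow> complex \<Rightarrow> complex" where
  "blaschke2 b z = z\<^sup>2 * (z - b) / (1 - cnj b * z)"

lemma blaschke2_denominator_nonzero: "cmod b \<le> 1 \<Longrightarrow> cmod x < 1 \<Longrightarrow> 1 - cnj b * x \<noteq> 0"
proof
  assume "cmod b \<le> 1" "cmod x < 1" "1 - cnj b * x = 0"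
  then have "1 = cmod b * cmod x" by (metis complex_mod_cnj norm_mult norm_one right_minus_eq)
  moreover have "cmod b * cmod x \<le> 1 * cmod x" using \<open>cmod b \<le> 1\<close> by (intro mult_right_mono) auto
  ultimately show False using \<open>cmod x < 1\<close> by simp
qed

lemma blaschke2_unimodular:
  assumes "cmod b = 1" "cmod z < 1"
  shows "blaschke2 b z = - b * z\<^sup>2"
proof -
  have "b * cnj b = 1" using assms by (simp add: complex_norm_square[symmetric])
  then have "z\<^sup>2 * (z - b) = - b * z\<^sup>2 * (1 - cnj b * z)" by (simp add: algebra_simps)
  then show ?thesis using blaschke2_denominator_nonzero[of b z] assms by (simp add: blaschke2_def)
qed

text \<open>Two free numbers let it serve both pointwise, with \<open>p = 1\<close> and
  \<open>q = z\<close>, and coefficient by coefficient, with \<open>p\<close> from \<open>g\<close>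
  and \<open>q\<close> from \<open>x * g\<close>.\<close>

lemma blaschke_numden:
  "(cmod (p - cnj b * q))\<^sup>2 - (cmod (q - b * p))\<^sup>2 = (1 - (cmod b)\<^sup>2) * ((cmod p)\<^sup>2 - (cmod q)\<^sup>2)"
  unfolding cmod_power2 by (simp add: algebra_simps power2_eq_square)

lemma norm_blaschke2_le_1:
  assumes b: "cmod b \<le> 1" and z: "cmod z < 1"
  shows "cmod (blaschke2 b z) \<le> 1"
proof -
  have "0 \<le> (1 - (cmod b)\<^sup>2) * ((cmod 1)\<^sup>2 - (cmod z)\<^sup>2)"
    using b z by (intro mult_nonneg_nonneg) (auto simp: power_le_one)
  then have "(cmod (z - b))\<^sup>2 \<le> (cmod (1 - cnj b * z))\<^sup>2"
    using blaschke_numden[of 1 b z] unfolding mult_1_right by linarith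
  then have "cmod (z - b) \<le> cmod (1 - cnj b * z)" by (rule power2_le_imp_le) simp
  moreover have "0 < cmod (1 - cnj b * z)" using blaschke2_denominator_nonzero[OF b z] by simp
  ultimately have "cmod (z - b) / cmod (1 - cnj b * z) \<le> 1" by simp
  moreover have "(cmod z)\<^sup>2 \<le> 1" using z by (simp add: power_le_one)
  ultimately have "(cmod z)\<^sup>2 * (cmod (z - b) / cmod (1 - cnj b * z)) \<le> 1"
    by (intro mult_le_one) auto
  then show ?thesis by (simp add: blaschke2_def norm_mult norm_divide norm_power)
qed

lemma norm_blaschke2_circle:
  assumes "cmod z = 1" "cnj b * z \<noteq> 1"
  shows "cmod (blaschke2 b z) = 1"
proof -
  have "z * cnj z = 1" using assms(1) by (simp add: complex_norm_square[symmetric])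
  then have "z - b = z * cnj (1 - cnj b * z)" by (simp add: algebra_simps)
  then have "cmod (z - b) = cmod (1 - cnj b * z)"
    using assms(1) by (metis complex_mod_cnj mult_1 norm_mult)
  then show ?thesis using assms by (simp add: blaschke2_def norm_divide norm_mult norm_power)
qed

text \<open>Inside the disc of parameters the denominator is nonzero at \<open>-1\<close>. For
  unimodular \<open>b\<close> it may vanish there, but then the function is
  \<open>- b * z\<^sup>2\<close> on the disc. The value \<open>- b\<close> is recorded so that all
  unimodular parameters can be shown to give the same normalised function.\<close>

lemma blaschke2_limit:
  assumes "cmod b \<le> 1"
  obtains l where "cmod l = 1" "(blaschke2 b \<longlongrightarrow> l) (at (-1) within ball 0 1)"
    "cmod b = 1 \<Longrightarrow> l = - b"
proof (cases "cmod b = 1")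
  case True
  have "((\<lambda>z. - b * z\<^sup>2) \<longlongrightarrow> - b * (-1)\<^sup>2) (at (-1) within ball 0 1)" by (intro tendsto_intros)
  moreover have "\<forall>\<^sub>F z in at (-1) within ball 0 1. - b * z\<^sup>2 = blaschke2 b z"
    using blaschke2_unimodular[OF True] by (auto simp: eventually_at_filter)
  ultimately have "(blaschke2 b \<longlongrightarrow> - b) (at (-1) within ball 0 1)"
    using tendsto_cong by force
  then show ?thesis using that[of "-b"] True by simp
next
  case False
  have nz: "1 - cnj b * (-1) \<noteq> 0"
  proof
    assume "1 - cnj b * (-1) = 0"
    then have "cnj b = -1" by (simp add: add_eq_0_iff)
    then have "cmod (cnj b) = 1" by simp
    with False show False by simp
  qed
  have "(blaschke2 b \<longlongrightarrow> blaschke2 b (-1)) (at (-1) within ball 0 1)"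
    unfolding blaschke2_def using nz by (intro tendsto_intros) auto
  moreover have "cmod (blaschke2 b (-1)) = 1"
  proof (rule norm_blaschke2_circle)
    show "cnj b * - 1 \<noteq> 1" using nz by (metis diff_self)
  qed simp
  ultimately show ?thesis using that False by blast
qed

section \<open>Interpolation at the fourth roots of 1/16\<close>
text \<open>Four points, so that every function on them is a cubic, just enough to hold
  \<open>x\<^sup>2 * (x - b)\<close>. As the roots of \<open>x ^ 4 = 1/16\<close> they turn
  multiplication by \<open>x\<close> into a weighted cyclic shift of coefficients.\<close>

definition nodes :: "complex set" where
  "nodes = {1/2, -1/2, \<i>/2, -\<i>/2}"

text \<open>Since \<open>4 * cnj x = inverse x\<close> and \<open>x ^ 4 = 1 / 16\<close> on the nodes, \<open>coef m f\<close> is the coefficient of \<open>x ^ m\<close> of the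
  cubic interpolating \<open>f\<close>.\<close>
definition coef :: "nat \<Rightarrow> (complex \<Rightarrow> complex) \<Rightarrow> complex" where
  "coef m f = (\<Sum>x\<in>nodes. (4 * cnj x)^m / 4 * f x)"

lemma finite_nodes [simp]: "finite nodes" by (simp add: nodes_def)

lemma nodes_sum: "(\<Sum>x\<in>nodes. h x) = h (1/2) + h (-1/2) + h (\<i>/2) + h (-\<i>/2)" for h :: "complex \<Rightarrow> complex"
proof -
  have "1/2 \<noteq> \<i>/2" "1/2 \<noteq> -\<i>/2" "-1/2 \<noteq> \<i>/2" "-1/2 \<noteq> -\<i>/2" "\<i>/2 \<noteq> -\<i>/2" "1/2 \<noteq> (-1/2::complex)"
    by (auto simp: complex_eq_iff)
  then show ?thesis unfolding nodes_def
    by (subst sum.insert; simp add: algebra_simps)+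
qed

lemma nodes_cases:
  assumes "x \<in> nodes"
  obtains "x = 1/2" | "x = -1/2" | "x = \<i>/2" | "x = -\<i>/2"
  using assms unfolding nodes_def by blast

lemma nodes_norm: "x \<in> nodes \<Longrightarrow> cmod x = 1/2"
  by (erule nodes_cases; hypsubst; simp add: norm_divide)

lemma nodes_ball: "x \<in> nodes \<Longrightarrow> x \<in> ball 0 1"
  by (simp add: nodes_norm del: eq_divide_eq_numeral1)

lemma nodes_cnj: "x \<in> nodes \<Longrightarrow> 4 * cnj x * x = 1"
  by (erule nodes_cases; hypsubst; simp)

lemma coef_cong: "(\<And>x. x \<in> nodes \<Longrightarrow> f x = g x) \<Longrightarrow> coef m f = coef m g"
  unfolding coef_def by (intro sum.cong) auto

lemma coef_add: "coef m (\<lambda>x. f x + g x) = coef m f + coef m g"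
  by (simp add: coef_def sum.distrib ring_distribs)

lemma coef_diff: "coef m (\<lambda>x. f x - g x) = coef m f - coef m g"
  by (simp add: coef_def sum_subtractf ring_distribs)

lemma coef_cmult: "coef m (\<lambda>x. c * f x) = c * coef m f"
  unfolding coef_def sum_distrib_left by (intro sum.cong) auto

text \<open>The wrap-around of the shift: \<open>x * x ^ 3\<close> is the constant
  \<open>1/16\<close> on the nodes.\<close>

lemma coef_shift_0: "coef 0 (\<lambda>x. x * f x) = coef 3 f / 16"
proof -
  have "x * f x / 4 = (4 * cnj x)^3 / 4 * f x / 16" if "x \<in> nodes" for x
    using that by (rule nodes_cases; hypsubst; simp add: power3_eq_cube)
  then show ?thesis unfolding coef_def sum_divide_distrib by (intro sum.cong refl) simp
qed

lemma coef_shift_Suc: "coef (Suc m) (\<lambda>x. x * f x) = coef m f"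
  unfolding coef_def
proof (intro sum.cong refl)
  fix x assume "x \<in> nodes"
  have "(4 * cnj x) ^ Suc m / 4 * (x * f x) = (4 * cnj x * x) * ((4 * cnj x) ^ m / 4 * f x)" by simp
  then show "(4 * cnj x) ^ Suc m / 4 * (x * f x) = (4 * cnj x) ^ m / 4 * f x"
    using nodes_cnj[OF \<open>x \<in> nodes\<close>] by simp
qed

lemma coef_shift:
  "coef 1 (\<lambda>x. x * f x) = coef 0 f" "coef 2 (\<lambda>x. x * f x) = coef 1 f" "coef 3 (\<lambda>x. x * f x) = coef 2 f"
  using coef_shift_Suc[of 0 f] coef_shift_Suc[of 1 f] coef_shift_Suc[of 2 f]
  by (simp_all add: numeral_2_eq_2 numeral_3_eq_3)

lemma coef_const: "coef 0 (\<lambda>x. c) = c" "coef 1 (\<lambda>x. c) = 0" "coef 2 (\<lambda>x. c) = 0" "coef 3 (\<lambda>x. c) = 0"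
  unfolding coef_def nodes_sum by (simp_all add: power3_eq_cube power2_eq_square)

text \<open>Horner form lets the shift rules evaluate the coefficients; the nested pairs carry the
  Euclidean norm whose unit sphere supplies compactness.\<close>

definition cubic :: "complex \<times> complex \<times> complex \<times> complex \<Rightarrow> complex \<Rightarrow> complex" where
  "cubic q x = fst q + x * (fst (snd q) + x * (fst (snd (snd q)) + x * snd (snd (snd q))))"

lemma coef_cubic:
  "coef 0 (cubic (q0,q1,q2,q3)) = q0" "coef 1 (cubic (q0,q1,q2,q3)) = q1"
  "coef 2 (cubic (q0,q1,q2,q3)) = q2" "coef 3 (cubic (q0,q1,q2,q3)) = q3"
  unfolding cubic_def fst_conv snd_conv
  by (simp_all only: coef_add coef_shift coef_const coef_shift_0, simp_all)

lemma cubic_interpolation: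
  assumes "x \<in> nodes"
  shows "f x = cubic (coef 0 f, coef 1 f, coef 2 f, coef 3 f) x"
  using assms unfolding cubic_def fst_conv snd_conv coef_def nodes_sum
  by (rule nodes_cases; hypsubst; simp add: field_simps power3_eq_cube power2_eq_square)

section \<open>Defect of multiplication by a Blaschke product\<close>

text \<open>As a quadratic form in the values on the nodes it has the matrix
  \<open>255/16 * x * cnj y / (1 - x * cnj y)\<close>, the Szego kernel up to a constant and the
  factor \<open>x * cnj y\<close>.\<close>

definition coef_norm2 :: "(complex \<Rightarrow> complex) \<Rightarrow> real" where
  "coef_norm2 f = (cmod (coef 0 f))\<^sup>2 + (cmod (coef 1 f))\<^sup>2 + (cmod (coef 2 f))\<^sup>2 + (cmod (coef 3 f))\<^sup>2"

lemma coef_norm2_shift: "coef_norm2 f - coef_norm2 (\<lambda>x. x * f x) = 255/256 * (cmod (coef 3 f))\<^sup>2"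
  unfolding coef_norm2_def coef_shift coef_shift_0 by (simp add: norm_divide power_divide)

text \<open>Applying \<open>blaschke_numden\<close> to each coefficient reduces the defect of a
  Blaschke factor to that of the shift, which is \<open>1 - 1/256\<close> times a single squared
  coefficient.\<close>

lemma coef_norm2_blaschke_factor:
  "coef_norm2 (\<lambda>x. g x - cnj b * (x * g x)) - coef_norm2 (\<lambda>x. x * g x - b * g x)
    = (1 - (cmod b)\<^sup>2) * (255/256 * (cmod (coef 3 g))\<^sup>2)"
proof -
  have "coef_norm2 (\<lambda>x. g x - cnj b * (x * g x)) - coef_norm2 (\<lambda>x. x * g x - b * g x)
    = (1 - (cmod b)\<^sup>2) * (coef_norm2 g - coef_norm2 (\<lambda>x. x * g x))"
    unfolding coef_norm2_def coef_diff coef_cmult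
    using blaschke_numden[of "coef 0 g" b "coef 0 (\<lambda>x. x * g x)"]
      blaschke_numden[of "coef 1 g" b "coef 1 (\<lambda>x. x * g x)"]
      blaschke_numden[of "coef 2 g" b "coef 2 (\<lambda>x. x * g x)"]
      blaschke_numden[of "coef 3 g" b "coef 3 (\<lambda>x. x * g x)"]
    by (simp add: ring_distribs)
  then show ?thesis by (simp add: coef_norm2_shift)
qed

lemma coef_norm2_cong: "(\<And>x. x \<in> nodes \<Longrightarrow> f x = g x) \<Longrightarrow> coef_norm2 f = coef_norm2 g"
  unfolding coef_norm2_def using coef_cong[of f g] by simp

text \<open>Two shifts and one Blaschke factor make up \<open>blaschke2 b\<close>, and their three
  defects telescope. Writing \<open>f\<close> as \<open>(1 - cnj b * x) * r\<close> clears the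
  denominator.\<close>

lemma coef_norm2_blaschke2:
  assumes "cmod b \<le> 1"
  shows "coef_norm2 f - coef_norm2 (\<lambda>x. blaschke2 b x * f x)
    = 255/256 * ((cmod (coef 3 f))\<^sup>2 + (cmod (coef 2 f))\<^sup>2
        + (1 - (cmod b)\<^sup>2) * (cmod (coef 1 (\<lambda>x. f x / (1 - cnj b * x))))\<^sup>2)"
proof -
  define r where "r = (\<lambda>x. f x / (1 - cnj b * x))"
  define g where "g = (\<lambda>x. x * (x * r x))"
  have f: "f x = (1 - cnj b * x) * r x" and
    num: "(1 - cnj b * x) * blaschke2 b x = x\<^sup>2 * (x - b)" if "x \<in> nodes" for x
    using blaschke2_denominator_nonzero[OF assms, of x] nodes_norm[OF that] by (simp_all add: r_def blaschke2_def)
  have 1: "coef_norm2 (\<lambda>x. x * (x * f x)) = coef_norm2 (\<lambda>x. g x - cnj b * (x * g x))"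
    by (intro coef_norm2_cong) (simp add: g_def f algebra_simps)
  have "blaschke2 b x * f x = x * g x - b * g x" if "x \<in> nodes" for x
  proof -
    have "blaschke2 b x * f x = ((1 - cnj b * x) * blaschke2 b x) * r x"
      using f[OF that] by simp
    then show ?thesis unfolding num[OF that] g_def by (simp add: algebra_simps power2_eq_square)
  qed
  then have 2: "coef_norm2 (\<lambda>x. blaschke2 b x * f x) = coef_norm2 (\<lambda>x. x * g x - b * g x)"
    by (rule coef_norm2_cong)
  have 3: "coef 3 g = coef 1 r" unfolding g_def coef_shift ..
  show ?thesis
    using coef_norm2_shift[of f] coef_norm2_shift[of "\<lambda>x. x * f x"] coef_norm2_blaschke_factor[of g b] 1 2 3
    unfolding r_def[symmetric] coef_shift
    by (simp add: algebra_simps)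
qed

text \<open>The \<open>\<eta>\<close> term vanishes on the extremal vectors of each \<open>blaschke2 b\<close> with \<open>cmod b < 1\<close>; it is there
  to make the form positive on those of \<open>z\<^sup>2\<close>.\<close>
definition gain :: "complex \<Rightarrow> real \<Rightarrow> (complex \<Rightarrow> complex) \<Rightarrow> real" where
  "gain a \<eta> f = (cmod (coef 1 f + cnj a * coef 0 f))\<^sup>2
     + \<eta> * ((cmod (coef 0 f))\<^sup>2 + (cmod (coef 3 f))\<^sup>2)"

lemma gain_cong: "(\<And>x. x \<in> nodes \<Longrightarrow> f x = g x) \<Longrightarrow> gain a \<eta> f = gain a \<eta> g"
  unfolding gain_def using coef_cong[of f g] by simp

text \<open>The case of \<open>z\<^sup>2\<close>, where the defect vanishes on all
  \<open>q0 + q1 * x\<close>. If the first term is zero, then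
  \<open>cmod q1 = cmod a * cmod q0\<close> and the second is positive; the factor
  \<open>(1 - (cmod a)\<^sup>2) / 2\<close> is small enough for the first term to win
  otherwise.\<close>

lemma circle_gain_pos:
  assumes "cmod a < 1" "q0 \<noteq> 0 \<or> q1 \<noteq> 0"
  shows "0 < (cmod (q1 + cnj a * q0))\<^sup>2 + (1 - (cmod a)\<^sup>2) / 2 * ((cmod q0)\<^sup>2 - (cmod q1)\<^sup>2)"
proof -
  define s t u e where "s = cmod (q1 + cnj a * q0)" and "t = cmod q0" and "u = cmod a"
    and "e = (1 - (cmod a)\<^sup>2) / 2"
  have u: "0 \<le> u" "u < 1" "u\<^sup>2 < 1" using assms by (auto simp: u_def power_less_one_iff)
  have e: "0 < e" "u\<^sup>2 = 1 - 2 * e" using u by (auto simp: e_def u_def field_simps)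
  have "cmod q1 \<le> s + u * t"
    using norm_triangle_ineq4[of "q1 + cnj a * q0" "cnj a * q0"]
    by (simp add: s_def u_def t_def norm_mult)
  then have q1: "(cmod q1)\<^sup>2 \<le> (s + u * t)\<^sup>2" by (intro power_mono) auto
  have nz: "s \<noteq> 0 \<or> t \<noteq> 0" using assms(2) by (auto simp: s_def t_def)
  have "s\<^sup>2 + e * (t\<^sup>2 - (s + u * t)\<^sup>2) = s\<^sup>2 * (1 - e) - 2 * e * u * s * t + e * t\<^sup>2 * (1 - u\<^sup>2)"
    by (simp add: power2_eq_square algebra_simps)
  \<comment> \<open>Since \<open>u\<^sup>2 = 1 - 2 * e\<close>, the mixed term completes to a square
    with a positive remainder.\<close>
  also have "\<dots> = (u * s - e * t)\<^sup>2 + e * s\<^sup>2 + e * e * t\<^sup>2"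
    unfolding power2_diff power_mult_distrib e(2) by (simp add: power2_eq_square algebra_simps)
  finally have eq: "s\<^sup>2 + e * (t\<^sup>2 - (s + u * t)\<^sup>2) = (u * s - e * t)\<^sup>2 + e * s\<^sup>2 + e * e * t\<^sup>2" .
  have "0 < e * s\<^sup>2 + e * e * t\<^sup>2" using nz e(1) by (auto simp: add_pos_nonneg add_nonneg_pos)
  then have "0 < s\<^sup>2 + e * (t\<^sup>2 - (s + u * t)\<^sup>2)" unfolding eq by (simp add: add_nonneg_pos add.assoc)
  also have "\<dots> \<le> s\<^sup>2 + e * (t\<^sup>2 - (cmod q1)\<^sup>2)" using q1 e(1) by simp
  finally show ?thesis by (simp add: s_def t_def e_def)
qed

lemma coef_eq_cubic:
  assumes "\<forall>x\<in>nodes. f x = cubic (q0,q1,q2,q3) x"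
  shows "coef 0 f = q0" "coef 1 f = q1" "coef 2 f = q2" "coef 3 f = q3"
  using coef_cong[of f "cubic (q0,q1,q2,q3)", OF bspec[OF assms]] by (simp_all only: coef_cubic)

text \<open>Zero defect kills coefficients 2 and 3. If \<open>cmod b < 1\<close> it also forces
  \<open>r\<close> to be constant, so \<open>f\<close> is a multiple of \<open>1 - cnj b * x\<close>
  and the difference is a positive multiple of \<open>(cmod (a - b))\<^sup>2\<close>. If
  \<open>cmod b = 1\<close>, coefficients 0 and 1 stay free and \<open>circle_gain_pos\<close> takes
  over.\<close>

lemma gain_blaschke2_pos:
  assumes a: "cmod a \<le> 1" and b: "cmod b \<le> 1" and ne: "a \<noteq> b" "cmod a < 1 \<or> cmod b < 1"
    and iso: "coef_norm2 f - coef_norm2 (\<lambda>x. blaschke2 b x * f x) = 0" and nz: "coef_norm2 f \<noteq> 0"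
  shows "0 < gain a ((1 - (cmod a)\<^sup>2) / 2) f - gain a ((1 - (cmod a)\<^sup>2) / 2) (\<lambda>x. blaschke2 b x * f x)"
proof -
  define r where "r = (\<lambda>x. f x / (1 - cnj b * x))"
  have b2: "0 \<le> 1 - (cmod b)\<^sup>2" using b by (simp add: power_le_one)
  have "f x = (1 - cnj b * x) * r x" and
    num: "(1 - cnj b * x) * blaschke2 b x = x\<^sup>2 * (x - b)" if "x \<in> nodes" for x
    using blaschke2_denominator_nonzero[OF b, of x] nodes_norm[OF that] by (simp_all add: r_def blaschke2_def)
  then have f: "f x = r x - cnj b * (x * r x)" if "x \<in> nodes" for x
    using that by (simp add: algebra_simps)
  have sum0: "(cmod (coef 3 f))\<^sup>2 + (cmod (coef 2 f))\<^sup>2 + (1 - (cmod b)\<^sup>2) * (cmod (coef 1 r))\<^sup>2 = 0"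
    using coef_norm2_blaschke2[OF b, of f] iso unfolding r_def by simp
  moreover have "0 \<le> (1 - (cmod b)\<^sup>2) * (cmod (coef 1 r))\<^sup>2" using b2 by simp
  ultimately have "(cmod (coef 3 f))\<^sup>2 = 0" "(cmod (coef 2 f))\<^sup>2 = 0"
    and r1: "(1 - (cmod b)\<^sup>2) * (cmod (coef 1 r))\<^sup>2 = 0"
    by (smt (verit) zero_le_power2)+
  then have f32: "coef 3 f = 0" "coef 2 f = 0" by auto
  show ?thesis
  proof (cases "cmod b < 1")
    case True
    then have "(cmod b)\<^sup>2 < 1" by (simp add: power_less_one_iff)
    then have r1: "coef 1 r = 0" using r1 by simp
    have cf: "coef m f = coef m r - cnj b * coef m (\<lambda>x. x * r x)" for m
      using coef_cong[of f "\<lambda>x. r x - cnj b * (x * r x)" m] f by (simp add: coef_diff coef_cmult)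
    \<comment> \<open>Comparing coefficients of \<open>f\<close> and \<open>r\<close> carries the
      zero from coefficient 1 of \<open>r\<close> up to coefficient 3.\<close>
    have r2: "coef 2 r = 0" using cf[of 2] f32 r1 by (simp add: coef_shift)
    have r3: "coef 3 r = 0" using cf[of 3] f32 r2 by (simp add: coef_shift)
    define c where "c = coef 0 r"
    have r: "r x = c" if "x \<in> nodes" for x
      using cubic_interpolation[OF that, of r] r1 r2 r3 by (simp add: cubic_def c_def)
    have fx: "f x = cubic (c, - cnj b * c, 0, 0) x" if "x \<in> nodes" for x
      using f[OF that] r[OF that] by (simp add: cubic_def)
    have gx: "blaschke2 b x * f x = cubic (0, 0, - b * c, c) x" if "x \<in> nodes" for x
    proof -
      have "blaschke2 b x * f x = ((1 - cnj b * x) * blaschke2 b x) * c"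
        unfolding f[OF that] r[OF that] by (simp add: algebra_simps)
      then show ?thesis unfolding num[OF that] by (simp add: cubic_def algebra_simps power2_eq_square)
    qed
    note coefs = coef_eq_cubic[of f, OF ballI, OF fx] coef_eq_cubic[of "\<lambda>x. blaschke2 b x * f x", OF ballI, OF gx]
    have "c \<noteq> 0" using nz unfolding coef_norm2_def by (auto simp: coefs simp del: One_nat_def)
    moreover have "- cnj b * c + cnj a * c = cnj (a - b) * c" by (simp add: algebra_simps)
    ultimately show ?thesis using ne(1)
      unfolding gain_def by (simp add: coefs norm_mult del: complex_cnj_diff One_nat_def)
  next
    case False
    with b have b1: "cmod b = 1" by simp
    then have a1: "cmod a < 1" using ne(2) by simp
    define q0 q1 where "q0 = coef 0 f" and "q1 = coef 1 f"
    have fx: "f x = cubic (q0, q1, 0, 0) x" if "x \<in> nodes" for x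
      using cubic_interpolation[OF that, of f] f32 by (simp add: q0_def q1_def)
    have gx: "blaschke2 b x * f x = cubic (0, 0, - b * q0, - b * q1) x" if "x \<in> nodes" for x
    proof -
      have "blaschke2 b x = - b * x\<^sup>2" using blaschke2_unimodular[OF b1, of x] nodes_norm[OF that] by simp
      then show ?thesis using fx[OF that] by (simp add: cubic_def algebra_simps power2_eq_square)
    qed
    note coefs = coef_eq_cubic[of f, OF ballI, OF fx] coef_eq_cubic[of "\<lambda>x. blaschke2 b x * f x", OF ballI, OF gx]
    have "q0 \<noteq> 0 \<or> q1 \<noteq> 0" using nz unfolding coef_norm2_def by (auto simp: coefs simp del: One_nat_def)
    from circle_gain_pos[OF a1 this] show ?thesis
      unfolding gain_def by (simp only: coefs) (simp add: norm_mult b1 algebra_simps)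
  qed
qed

section \<open>Compactness and the contractive test form\<close>

text \<open>Where \<open>B\<close> is not positive, \<open>A\<close> cannot vanish, so compactness
  bounds \<open>A\<close> below there and a large multiple of it outweighs \<open>B\<close>. The
  clause \<open>\<delta> \<le> N\<close> is what later keeps the perturbed form nonnegative.\<close>

lemma compact_penalty:
  fixes A B :: "'a::topological_space \<Rightarrow> real"
  assumes Q: "compact Q" and cA: "continuous_on Q A" and cB: "continuous_on Q B"
    and A: "\<And>z. z \<in> Q \<Longrightarrow> 0 \<le> A z" and B: "\<And>z. z \<in> Q \<Longrightarrow> A z = 0 \<Longrightarrow> 0 < B z"
  obtains N \<delta> where "0 < \<delta>" "\<delta> \<le> N" "\<And>z. z \<in> Q \<Longrightarrow> \<delta> \<le> N * A z + B z"
proof (cases "Q = {}")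
  case True
  then show ?thesis using that[of 1 1] by simp
next
  case ne: False
  obtain m where m: "m \<in> Q" "\<And>z. z \<in> Q \<Longrightarrow> B m \<le> B z"
    using continuous_attains_inf[OF Q ne cB] by blast
  define L where "L = Q \<inter> B -` {..0}"
  obtain N where N: "\<And>z. z \<in> Q \<Longrightarrow> 0 < N * A z + B z" "0 \<le> N"
  proof (cases "L = {}")
    case True
    then show ?thesis using that[of 0] by (force simp: L_def)
  next
    case False
    obtain T where T: "closed T" "B -` {..0} \<inter> Q = T \<inter> Q"
      using continuous_on_closed_invariant[THEN iffD1, OF cB] by (metis closed_atMost)
    have "compact L" unfolding L_def using T Q compact_Int_closed by (metis Int_commute)
    moreover have "continuous_on L A" using cA by (rule continuous_on_subset) (auto simp: L_def)
    ultimately obtain l where l: "l \<in> L" "\<And>z. z \<in> L \<Longrightarrow> A l \<le> A z"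
      using continuous_attains_inf[of L A] False by blast
    have Al: "0 < A l" using l(1) A[of l] B[of l] by (force simp: L_def)
    \<comment> \<open>Even the smallest value \<open>A l\<close> on \<open>L\<close> then outweighs
      the minimum \<open>B m\<close> by at least 1.\<close>
    define N where "N = (1 + \<bar>B m\<bar>) / A l"
    have "0 < N * A z + B z" if "z \<in> Q" for z
    proof (cases "z \<in> L")
      case True
      have "1 + \<bar>B m\<bar> = N * A l" using Al by (simp add: N_def)
      also have "\<dots> \<le> N * A z" using l(2)[OF True] Al by (intro mult_left_mono) (auto simp: N_def)
      finally show ?thesis using m(2)[OF that] by linarith
    next
      case False
      then have "0 < B z" using that by (auto simp: L_def)
      moreover have "0 \<le> N * A z" using A[OF that] Al by (auto simp: N_def)
      ultimately show ?thesis by linarith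
    qed
    moreover have "0 \<le> N" using Al by (simp add: N_def)
    ultimately show ?thesis using that by blast
  qed
  obtain p where p: "p \<in> Q" "\<And>z. z \<in> Q \<Longrightarrow> N * A p + B p \<le> N * A z + B z"
  proof -
    have "continuous_on Q (\<lambda>z. N * A z + B z)" using cA cB by (intro continuous_intros)
    from continuous_attains_inf[OF Q ne this] show ?thesis using that by blast
  qed
  define \<delta> where "\<delta> = N * A p + B p"
  show ?thesis
  \<comment> \<open>Raising \<open>N\<close> to secure \<open>\<delta> \<le> N\<close> is harmless
    because \<open>A\<close> is nonnegative.\<close>
  proof (rule that[of \<delta> "max N \<delta>"])
    show "0 < \<delta>" using N(1)[OF p(1)] by (simp add: \<delta>_def)
    fix z assume z: "z \<in> Q"
    have "N * A z \<le> max N \<delta> * A z" using A[OF z] by (intro mult_right_mono) auto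
    then show "\<delta> \<le> max N \<delta> * A z + B z" using p(2)[OF z] by (simp add: \<delta>_def)
  qed simp
qed

lemma continuous_on_coef_cubic:
  "continuous_on S (\<lambda>z. coef m (cubic (snd z)))"
  unfolding coef_def cubic_def by (intro continuous_intros)

lemma continuous_on_coef_blaschke2:
  assumes "fst ` S \<subseteq> cball 0 1"
  shows "continuous_on S (\<lambda>z. coef m (\<lambda>x. blaschke2 (fst z) x * cubic (snd z) x))"
  unfolding coef_def cubic_def blaschke2_def
proof (intro continuous_intros ballI)
  fix x z assume "x \<in> nodes" "z \<in> S"
  then show "1 - cnj (fst z) * x \<noteq> 0" using assms by (intro blaschke2_denominator_nonzero) (auto simp: nodes_norm)
qed

definition test_form :: "complex \<Rightarrow> real \<Rightarrow> real \<Rightarrow> (complex \<Rightarrow> complex) \<Rightarrow> real" where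
  "test_form a N \<epsilon> f = N * coef_norm2 f + gain a ((1 - (cmod a)\<^sup>2) / 2) f - \<epsilon> * (cmod (coef 0 f))\<^sup>2"

lemma test_form_cong: "(\<And>x. x \<in> nodes \<Longrightarrow> f x = g x) \<Longrightarrow> test_form a N \<epsilon> f = test_form a N \<epsilon> g"
  unfolding test_form_def using coef_cong[of f g] coef_norm2_cong[of f g] gain_cong[of f g] by simp

lemma test_form_cmult: "test_form a N \<epsilon> (\<lambda>x. c * f x) = (cmod c)\<^sup>2 * test_form a N \<epsilon> f"
proof -
  have "c * coef 1 f + cnj a * (c * coef 0 f) = c * (coef 1 f + cnj a * coef 0 f)"
    by (simp add: algebra_simps)
  then show ?thesis
    unfolding test_form_def coef_norm2_def gain_def coef_cmult
    by (simp only: norm_mult power_mult_distrib) (simp add: algebra_simps)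
qed

lemma test_form_nonneg:
  assumes "cmod a \<le> 1" "\<epsilon> \<le> N" "0 < \<epsilon>"
  shows "0 \<le> test_form a N \<epsilon> f"
proof -
  have "(cmod a)\<^sup>2 \<le> 1" using assms(1) by (simp add: power_le_one)
  then have "0 \<le> gain a ((1 - (cmod a)\<^sup>2) / 2) f" unfolding gain_def by (auto intro!: add_nonneg_nonneg)
  moreover have "\<epsilon> * (cmod (coef 0 f))\<^sup>2 \<le> N * (cmod (coef 0 f))\<^sup>2" using assms by (intro mult_right_mono) auto
  moreover have "N * (cmod (coef 0 f))\<^sup>2 \<le> N * coef_norm2 f" using assms unfolding coef_norm2_def by (intro mult_left_mono) auto
  ultimately show ?thesis unfolding test_form_def by linarith
qed

text \<open>By homogeneity it suffices to treat unit coefficient vectors, which together with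
  \<open>K\<close> form a compact set. The hypothesis \<open>circ\<close> excludes two unimodular
  parameters, whose functions differ only by a constant factor on the disc.\<close>

lemma test_form_contractive:
  assumes K: "compact K" "K \<subseteq> cball 0 1" and a: "cmod a \<le> 1" "a \<notin> K"
    and circ: "\<And>b. b \<in> K \<Longrightarrow> cmod a < 1 \<or> cmod b < 1"
  obtains N \<epsilon> where "0 < \<epsilon>" "\<epsilon> \<le> N"
    "\<And>b f. b \<in> K \<Longrightarrow> test_form a N \<epsilon> (\<lambda>x. blaschke2 b x * f x) \<le> test_form a N \<epsilon> f"
proof -
  define \<eta> where "\<eta> = (1 - (cmod a)\<^sup>2) / 2"
  define Q :: "(complex \<times> (complex \<times> complex \<times> complex \<times> complex)) set" where "Q = K \<times> sphere 0 1"
  define A where "A = (\<lambda>z. coef_norm2 (cubic (snd z)) - coef_norm2 (\<lambda>x. blaschke2 (fst z) x * cubic (snd z) x))"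
  define B where "B = (\<lambda>z. gain a \<eta> (cubic (snd z)) - gain a \<eta> (\<lambda>x. blaschke2 (fst z) x * cubic (snd z) x))"
  have sub: "fst ` Q \<subseteq> cball 0 1" using K(2) by (auto simp: Q_def)
  note cont = continuous_on_coef_cubic continuous_on_coef_blaschke2[OF sub]
  have "compact Q" unfolding Q_def using K(1) by (intro compact_Times) auto
  moreover have "continuous_on Q A" "continuous_on Q B"
    unfolding A_def B_def coef_norm2_def gain_def by (intro continuous_intros cont)+
  moreover have "0 \<le> A z" if "z \<in> Q" for z
  proof -
    have b: "cmod (fst z) \<le> 1" using sub that by auto
    then show ?thesis unfolding A_def coef_norm2_blaschke2[OF b]
      by (auto intro!: mult_nonneg_nonneg add_nonneg_nonneg simp: power_le_one)
  qed
  moreover have "0 < B z" if z: "z \<in> Q" and 0: "A z = 0" for z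
  proof -
    obtain b q0 q1 q2 q3 where z_eq: "z = (b,q0,q1,q2,q3)" by (cases z) auto
    have b: "b \<in> K" and "norm (q0,q1,q2,q3) = 1" using z by (auto simp: Q_def z_eq)
    then have "(q0,q1,q2,q3) \<noteq> 0" by auto
    then have "q0 \<noteq> 0 \<or> q1 \<noteq> 0 \<or> q2 \<noteq> 0 \<or> q3 \<noteq> 0" by (auto simp: zero_prod_def)
    then have "coef_norm2 (cubic (q0,q1,q2,q3)) \<noteq> 0" unfolding coef_norm2_def coef_cubic
      by (auto simp: add_nonneg_eq_0_iff)
    moreover have "cmod b \<le> 1" "a \<noteq> b" "cmod a < 1 \<or> cmod b < 1" using b K(2) a(2) circ by auto
    ultimately show ?thesis unfolding B_def \<eta>_def
      using gain_blaschke2_pos[OF a(1), of b "cubic (q0,q1,q2,q3)"] 0 unfolding A_def z_eq by simp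
  qed
  ultimately obtain N \<delta> where \<delta>: "0 < \<delta>" "\<delta> \<le> N" "\<And>z. z \<in> Q \<Longrightarrow> \<delta> \<le> N * A z + B z"
    using compact_penalty[of Q A B] by blast
  have unit: "test_form a N \<delta> (\<lambda>x. blaschke2 b x * cubic q x) \<le> test_form a N \<delta> (cubic q)"
    if "b \<in> K" "norm q = 1" for b q
  proof -
    \<comment> \<open>On unit vectors coefficient 0 has modulus at most 1, so the margin
      \<open>\<delta>\<close> pays for the subtracted term; hence the choice
      \<open>\<epsilon> = \<delta>\<close>.\<close>
    have "\<delta> \<le> N * A (b,q) + B (b,q)" using \<delta>(3)[of "(b,q)"] that by (auto simp: Q_def)
    moreover have "cmod (coef 0 (cubic q)) \<le> 1"
      using norm_fst_le[of "fst q" "snd q"] that(2) by (cases q) (simp add: coef_cubic)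
    then have "\<delta> * (cmod (coef 0 (cubic q)))\<^sup>2 \<le> \<delta> * 1"
      using \<delta>(1) by (intro mult_left_mono) (auto simp: power_le_one)
    moreover have "0 \<le> \<delta> * (cmod (coef 0 (\<lambda>x. blaschke2 b x * cubic q x)))\<^sup>2" using \<delta>(1) by simp
    ultimately show ?thesis unfolding test_form_def A_def B_def \<eta>_def
      by (simp add: algebra_simps)
  qed
  show ?thesis
  proof (rule that[OF \<delta>(1,2)])
    fix b f assume b: "b \<in> K"
    define q where "q = (coef 0 f, coef 1 f, coef 2 f, coef 3 f)"
    have f: "f x = cubic q x" if "x \<in> nodes" for x using cubic_interpolation[OF that, of f] by (simp add: q_def)
    obtain u where u: "norm u = 1" "q = norm q *\<^sub>R u"
    proof (cases "q = 0")
      case True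
      have "norm (1::complex, 0::complex, 0::complex, 0::complex) = 1" by (simp add: norm_Pair)
      then show ?thesis using that True by fastforce
    next
      case False
      then show ?thesis using that[of "q /\<^sub>R norm q"] by simp
    qed
    have "cubic q x = of_real (norm q) * cubic u x" for x
      by (subst u(2)) (simp add: cubic_def scaleR_conv_of_real algebra_simps)
    then have f': "f x = of_real (norm q) * cubic u x" if "x \<in> nodes" for x using f[OF that] by simp
    have "test_form a N \<delta> (\<lambda>x. blaschke2 b x * f x)
        = test_form a N \<delta> (\<lambda>x. of_real (norm q) * (blaschke2 b x * cubic u x))"
      by (rule test_form_cong) (simp add: f')
    moreover have "test_form a N \<delta> f = test_form a N \<delta> (\<lambda>x. of_real (norm q) * cubic u x)"
      by (rule test_form_cong) (simp add: f')
    ultimately show "test_form a N \<delta> (\<lambda>x. blaschke2 b x * f x) \<le> test_form a N \<delta> f"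
      unfolding test_form_cmult using unit[OF b u(1)] by (simp add: mult_left_mono)
  qed
qed

text \<open>The product is \<open>x\<^sup>2 * (x - a)\<close>, with the same coefficient norm and
  the same gain as \<open>1 - cnj a * x\<close>. Only the \<open>\<epsilon>\<close> term notices
  that coefficient 0 has dropped from 1 to 0.\<close>

lemma test_form_blaschke2_self:
  assumes "cmod a \<le> 1"
  shows "test_form a N \<epsilon> (\<lambda>x. blaschke2 a x * (1 - cnj a * x)) = test_form a N \<epsilon> (\<lambda>x. 1 - cnj a * x) + \<epsilon>"
proof -
  have 1: "\<forall>x\<in>nodes. 1 - cnj a * x = cubic (1, - cnj a, 0, 0) x" by (simp add: cubic_def)
  have 2: "\<forall>x\<in>nodes. blaschke2 a x * (1 - cnj a * x) = cubic (0, 0, - a, 1) x"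
  proof
    fix x assume "x \<in> nodes"
    then have "blaschke2 a x * (1 - cnj a * x) = x\<^sup>2 * (x - a)"
      using blaschke2_denominator_nonzero[OF assms, of x] nodes_norm[of x] by (simp add: blaschke2_def)
    then show "blaschke2 a x * (1 - cnj a * x) = cubic (0, 0, - a, 1) x"
      by (simp add: cubic_def algebra_simps power2_eq_square)
  qed
  show ?thesis
    unfolding test_form_def coef_norm2_def gain_def coef_eq_cubic[OF 1] coef_eq_cubic[OF 2]
    by (simp add: algebra_simps)
qed

section \<open>Kernels supported on finitely many points\<close>

lemma psd_kernel_cong:
  assumes "\<And>x y. x \<in> ball 0 1 \<Longrightarrow> y \<in> ball 0 1 \<Longrightarrow> k x y = k' x y"
  shows "psd_kernel k \<longleftrightarrow> psd_kernel k'"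
proof -
  have "(\<Sum>i<n. \<Sum>j<n. c i * cnj (c j) * k (x i) (x j)) = (\<Sum>i<n. \<Sum>j<n. c i * cnj (c j) * k' (x i) (x j))"
    if "\<forall>i<n. x i \<in> ball 0 1" for n :: nat and x c
    using that assms by (intro sum.cong refl) simp
  then show ?thesis unfolding psd_kernel_def Let_def by simp
qed

text \<open>Expansion turns the double sum into a weighted sum of squares. Samples outside
  \<open>F\<close> contribute nothing and repeated samples merge, so all finite samples reduce to
  one vector \<open>d\<close> on \<open>F\<close>.\<close>

lemma psd_kernel_weighted_sum:
  fixes T :: "'t \<Rightarrow> complex \<Rightarrow> complex" and w :: "'t \<Rightarrow> real"
  assumes F: "finite F" "F \<subseteq> ball 0 1" and T: "\<And>t x. t \<in> I \<Longrightarrow> x \<notin> F \<Longrightarrow> T t x = 0"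
  shows "psd_kernel (\<lambda>x y. (1 - \<zeta> x * cnj (\<zeta> y)) * (\<Sum>t\<in>I. of_real (w t) * T t x * cnj (T t y)))
    \<longleftrightarrow> (\<forall>d. 0 \<le> (\<Sum>t\<in>I. w t * ((cmod (\<Sum>x\<in>F. d x * T t x))\<^sup>2 - (cmod (\<Sum>x\<in>F. d x * \<zeta> x * T t x))\<^sup>2)))"
    (is "psd_kernel ?k \<longleftrightarrow> (\<forall>d. 0 \<le> ?q d)")
proof -
  have sq: "(\<Sum>i<n. \<Sum>j<n. f i * cnj (f j)) = of_real ((cmod (\<Sum>i<n. f i))\<^sup>2)" for f :: "nat \<Rightarrow> complex" and n :: nat
    unfolding complex_norm_square cnj_sum sum_product ..
  have form: "(\<Sum>i<n. \<Sum>j<n. c i * cnj (c j) * ?k (x i) (x j))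
      = of_real (\<Sum>t\<in>I. w t * ((cmod (\<Sum>i<n. c i * T t (x i)))\<^sup>2 - (cmod (\<Sum>i<n. c i * \<zeta> (x i) * T t (x i)))\<^sup>2))"
    for n :: nat and x c
  proof -
    have "(\<Sum>i<n. \<Sum>j<n. c i * cnj (c j) * ?k (x i) (x j))
      = (\<Sum>i<n. \<Sum>j<n. \<Sum>t\<in>I. of_real (w t) * ((c i * T t (x i)) * cnj (c j * T t (x j))
          - (c i * \<zeta> (x i) * T t (x i)) * cnj (c j * \<zeta> (x j) * T t (x j))))"
      unfolding sum_distrib_left by (intro sum.cong refl) (simp add: algebra_simps)
    also have "\<dots> = (\<Sum>i<n. \<Sum>t\<in>I. \<Sum>j<n. of_real (w t) * ((c i * T t (x i)) * cnj (c j * T t (x j))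
          - (c i * \<zeta> (x i) * T t (x i)) * cnj (c j * \<zeta> (x j) * T t (x j))))"
      by (intro sum.cong refl sum.swap)
    also have "\<dots> = (\<Sum>t\<in>I. \<Sum>i<n. \<Sum>j<n. of_real (w t) * ((c i * T t (x i)) * cnj (c j * T t (x j))
          - (c i * \<zeta> (x i) * T t (x i)) * cnj (c j * \<zeta> (x j) * T t (x j))))"
      by (rule sum.swap)
    also have "\<dots> = (\<Sum>t\<in>I. of_real (w t) * (of_real ((cmod (\<Sum>i<n. c i * T t (x i)))\<^sup>2)
          - of_real ((cmod (\<Sum>i<n. c i * \<zeta> (x i) * T t (x i)))\<^sup>2)))"
    proof (rule sum.cong[OF refl])
      fix t
      have "(\<Sum>i<n. \<Sum>j<n. of_real (w t) * ((c i * T t (x i)) * cnj (c j * T t (x j))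
          - (c i * \<zeta> (x i) * T t (x i)) * cnj (c j * \<zeta> (x j) * T t (x j))))
        = of_real (w t) * ((\<Sum>i<n. \<Sum>j<n. (c i * T t (x i)) * cnj (c j * T t (x j)))
          - (\<Sum>i<n. \<Sum>j<n. (c i * \<zeta> (x i) * T t (x i)) * cnj (c j * \<zeta> (x j) * T t (x j))))"
        by (simp only: sum_distrib_left sum_subtractf right_diff_distrib)
      then show "(\<Sum>i<n. \<Sum>j<n. of_real (w t) * ((c i * T t (x i)) * cnj (c j * T t (x j))
          - (c i * \<zeta> (x i) * T t (x i)) * cnj (c j * \<zeta> (x j) * T t (x j))))
        = of_real (w t) * (of_real ((cmod (\<Sum>i<n. c i * T t (x i)))\<^sup>2)
          - of_real ((cmod (\<Sum>i<n. c i * \<zeta> (x i) * T t (x i)))\<^sup>2))"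
        unfolding sq .
    qed
    finally show ?thesis by simp
  qed
  \<comment> \<open>The sample points need not be distinct: the weights of all samples at
    \<open>y\<close> are added up.\<close>
  have collect: "(\<Sum>i<n. c i * h (x i)) = (\<Sum>y\<in>F. (\<Sum>i | i < n \<and> x i = y. c i) * h y)"
    if "\<And>y. y \<notin> F \<Longrightarrow> h y = 0" for n :: nat and c x and h :: "complex \<Rightarrow> complex"
  proof -
    have "(\<Sum>y\<in>F. (\<Sum>i | i < n \<and> x i = y. c i) * h y) = (\<Sum>y\<in>F. \<Sum>i<n. if x i = y then c i * h (x i) else 0)"
    proof (rule sum.cong[OF refl])
      fix y
      have "(\<Sum>i | i < n \<and> x i = y. c i) * h y = (\<Sum>i\<in>{i \<in> {..<n}. x i = y}. c i * h (x i))"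
        unfolding sum_distrib_right by (intro sum.cong) auto
      also have "\<dots> = (\<Sum>i<n. if x i = y then c i * h (x i) else 0)" by (rule sum.inter_filter) simp
      finally show "(\<Sum>i | i < n \<and> x i = y. c i) * h y = \<dots>" .
    qed
    also have "\<dots> = (\<Sum>i<n. \<Sum>y\<in>F. if x i = y then c i * h (x i) else 0)" by (rule sum.swap)
    also have "\<dots> = (\<Sum>i<n. c i * h (x i))" using that F by (intro sum.cong refl) (auto simp: sum.delta)
    finally show ?thesis ..
  qed
  show ?thesis
  proof
    assume psd: "psd_kernel ?k"
    show "\<forall>d. 0 \<le> ?q d"
    proof
      fix d
      obtain h where h: "bij_betw h {0..<card F} F" using ex_bij_betw_nat_finite[OF F(1)] by blast
      have re: "(\<Sum>i<card F. g (h i)) = (\<Sum>x\<in>F. g x)" for g :: "complex \<Rightarrow> complex"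
        using sum.reindex_bij_betw[OF h] by (simp add: atLeast0LessThan)
      have "\<forall>i<card F. h i \<in> ball 0 1" using bij_betwE[OF h] F(2) by (metis atLeast0LessThan lessThan_iff subsetD)
      then have "0 \<le> Re (\<Sum>i<card F. \<Sum>j<card F. d (h i) * cnj (d (h j)) * ?k (h i) (h j))"
        using psd[unfolded psd_kernel_def Let_def, rule_format, of "card F" h "\<lambda>i. d (h i)"] by simp
      then show "0 \<le> ?q d"
        unfolding form[where c = "\<lambda>i. d (h i)"] Re_complex_of_real
          re[where g = "\<lambda>x. d x * T _ x"] re[where g = "\<lambda>x. d x * \<zeta> x * T _ x"] .
    qed
  next
    assume q: "\<forall>d. 0 \<le> ?q d"
    show "psd_kernel ?k"
      unfolding psd_kernel_def Let_def
    proof (intro allI impI)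
      fix n :: nat and x c :: "nat \<Rightarrow> complex"
      define d where "d = (\<lambda>y. \<Sum>i | i < n \<and> x i = y. c i)"
      have "(\<Sum>i<n. \<Sum>j<n. c i * cnj (c j) * ?k (x i) (x j)) = of_real (?q d)"
        unfolding form
      proof (intro arg_cong[of _ _ of_real] sum.cong refl)
        fix t assume t: "t \<in> I"
        have "(\<Sum>i<n. c i * T t (x i)) = (\<Sum>y\<in>F. d y * T t y)"
          unfolding d_def by (rule collect) (rule T[OF t])
        moreover have "(\<Sum>i<n. c i * (\<zeta> (x i) * T t (x i))) = (\<Sum>y\<in>F. d y * (\<zeta> y * T t y))"
          unfolding d_def by (rule collect) (simp add: T[OF t])
        ultimately show "w t * ((cmod (\<Sum>i<n. c i * T t (x i)))\<^sup>2 - (cmod (\<Sum>i<n. c i * \<zeta> (x i) * T t (x i)))\<^sup>2)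
          = w t * ((cmod (\<Sum>x\<in>F. d x * T t x))\<^sup>2 - (cmod (\<Sum>x\<in>F. d x * \<zeta> x * T t x))\<^sup>2)"
          by (simp only: mult.assoc)
      qed
      then show "Im (\<Sum>i<n. \<Sum>j<n. c i * cnj (c j) * ?k (x i) (x j)) = 0 \<and> 0 \<le> Re (\<Sum>i<n. \<Sum>j<n. c i * cnj (c j) * ?k (x i) (x j))"
        using q[rule_format, of d] by (simp only: Im_complex_of_real Re_complex_of_real simp_thms)
    qed
  qed
qed

text \<open>The kernel is the Gram kernel of \<open>test_form\<close>, so contractivity of the form
  becomes positivity. The last conclusion says that \<open>blaschke2 a\<close> has norm at least the
  square root of \<open>\<beta> / \<alpha>\<close>, if \<open>\<alpha>\<close> is positive.\<close>

lemma separating_kernel: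
  assumes K: "compact K" "K \<subseteq> cball 0 1" and a: "cmod a \<le> 1" "a \<notin> K"
    and circ: "\<And>b. b \<in> K \<Longrightarrow> cmod a < 1 \<or> cmod b < 1"
  obtains k \<alpha> \<beta> where "psd_kernel k"
    "\<And>b. b \<in> K \<Longrightarrow> psd_kernel (\<lambda>x y. (1 - blaschke2 b x * cnj (blaschke2 b y)) * k x y)"
    "0 \<le> \<alpha>" "\<alpha> < \<beta>"
    "\<And>s. 0 < s \<Longrightarrow> psd_kernel (\<lambda>x y. (1 - (blaschke2 a x / of_real s) * cnj (blaschke2 a y / of_real s)) * k x y)
       \<Longrightarrow> \<beta> \<le> \<alpha> * s\<^sup>2"
proof -
  obtain N \<epsilon> where N: "0 < \<epsilon>" "\<epsilon> \<le> N" and contr: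
    "\<And>b f. b \<in> K \<Longrightarrow> test_form a N \<epsilon> (\<lambda>x. blaschke2 b x * f x) \<le> test_form a N \<epsilon> f"
    using test_form_contractive[OF assms] by metis
  define \<eta> where "\<eta> = (1 - (cmod a)\<^sup>2) / 2"
  \<comment> \<open>Functionals 0 to 3 are the coefficients, and 4 is
    \<open>coef 1 + cnj a * coef 0\<close> from the gain. The factor \<open>1 - cnj a * x\<close>
    built into \<open>T\<close> turns the decisive vector into the constant
    \<open>d = 1\<close>.\<close>
  define w :: "nat \<Rightarrow> real" where "w = (\<lambda>t. if t = 0 then N + \<eta> - \<epsilon> else if t = 3 then N + \<eta> else if t = 4 then 1 else N)"
  define T :: "nat \<Rightarrow> complex \<Rightarrow> complex" where "T = (\<lambda>t x. if x \<in> nodes then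
      (if t = 4 then (4 * cnj x)^1 / 4 + cnj a * ((4 * cnj x)^0 / 4) else (4 * cnj x)^t / 4) * (1 - cnj a * x) else 0)"
  define k where "k = (\<lambda>x y. \<Sum>t\<le>4. of_real (w t) * T t x * cnj (T t y))"
  have T_coef: "(\<Sum>x\<in>nodes. d x * T t x) = coef t (\<lambda>x. d x * (1 - cnj a * x))" if "t \<noteq> 4" for t d
    unfolding coef_def by (intro sum.cong refl) (simp add: T_def that)
  have T_4: "(\<Sum>x\<in>nodes. d x * T 4 x) = coef 1 (\<lambda>x. d x * (1 - cnj a * x)) + cnj a * coef 0 (\<lambda>x. d x * (1 - cnj a * x))" for d
    unfolding coef_def sum_distrib_left sum.distrib[symmetric]
    by (intro sum.cong refl) (simp add: T_def field_simps)
  have I: "{..4::nat} = {0,1,2,3,4}" by auto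
  have form: "(\<Sum>t\<le>4. w t * (cmod (\<Sum>x\<in>nodes. d x * T t x))\<^sup>2) = test_form a N \<epsilon> (\<lambda>x. d x * (1 - cnj a * x))" for d
    unfolding I test_form_def coef_norm2_def gain_def \<eta>_def[symmetric]
    by (simp add: T_coef T_4 w_def algebra_simps)
  have psd_iff: "psd_kernel (\<lambda>x y. (1 - \<zeta> x * cnj (\<zeta> y)) * k x y)
      \<longleftrightarrow> (\<forall>d. test_form a N \<epsilon> (\<lambda>x. d x * \<zeta> x * (1 - cnj a * x)) \<le> test_form a N \<epsilon> (\<lambda>x. d x * (1 - cnj a * x)))" for \<zeta>
  proof -
    have F: "nodes \<subseteq> ball 0 1" using nodes_ball by blast
    have "psd_kernel (\<lambda>x y. (1 - \<zeta> x * cnj (\<zeta> y)) * k x y)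
      \<longleftrightarrow> (\<forall>d. 0 \<le> (\<Sum>t\<le>4. w t * ((cmod (\<Sum>x\<in>nodes. d x * T t x))\<^sup>2 - (cmod (\<Sum>x\<in>nodes. d x * \<zeta> x * T t x))\<^sup>2)))"
      unfolding k_def by (rule psd_kernel_weighted_sum[OF finite_nodes F]) (simp add: T_def)
    then show ?thesis by (simp only: right_diff_distrib[of "w _"] sum_subtractf form diff_ge_0_iff_ge)
  qed
  define \<alpha> where "\<alpha> = test_form a N \<epsilon> (\<lambda>x. 1 - cnj a * x)"
  show ?thesis
  proof (rule that[of k \<alpha> "\<alpha> + \<epsilon>"])
    \<comment> \<open>Positivity of \<open>k\<close> itself is the case of the zero
      multiplier.\<close>
    have "psd_kernel (\<lambda>x y. (1 - (\<lambda>_. 0) x * cnj ((\<lambda>_. 0) y)) * k x y)"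
      unfolding psd_iff using test_form_cmult[of a N \<epsilon> 0 "\<lambda>_. 0"] test_form_nonneg[OF a(1) N(2,1)] by simp
    then show "psd_kernel k" by simp
    show "psd_kernel (\<lambda>x y. (1 - blaschke2 b x * cnj (blaschke2 b y)) * k x y)" if "b \<in> K" for b
      unfolding psd_iff
    proof
      fix d
      show "test_form a N \<epsilon> (\<lambda>x. d x * blaschke2 b x * (1 - cnj a * x)) \<le> test_form a N \<epsilon> (\<lambda>x. d x * (1 - cnj a * x))"
        using contr[OF that, of "\<lambda>x. d x * (1 - cnj a * x)"] by (simp only: ac_simps)
    qed
    show "0 \<le> \<alpha>" unfolding \<alpha>_def by (rule test_form_nonneg[OF a(1) N(2,1)])
    show "\<alpha> < \<alpha> + \<epsilon>" using N by simp
    fix s :: real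
    assume s: "0 < s" and "psd_kernel (\<lambda>x y. (1 - (blaschke2 a x / of_real s) * cnj (blaschke2 a y / of_real s)) * k x y)"
    then have "test_form a N \<epsilon> (\<lambda>x. 1 * (blaschke2 a x / of_real s) * (1 - cnj a * x)) \<le> test_form a N \<epsilon> (\<lambda>x. 1 * (1 - cnj a * x))"
      unfolding psd_iff[of "\<lambda>x. blaschke2 a x / of_real s"]
      by (elim allE[where x = "\<lambda>_. 1"])
    moreover have "(\<lambda>x. 1 * (blaschke2 a x / of_real s) * (1 - cnj a * x)) = (\<lambda>x. of_real (1 / s) * (blaschke2 a x * (1 - cnj a * x)))"
      by (simp add: fun_eq_iff)
    ultimately have "(cmod (of_real (1 / s)))\<^sup>2 * (\<alpha> + \<epsilon>) \<le> \<alpha>"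
      unfolding \<alpha>_def by (simp only: test_form_cmult test_form_blaschke2_self[OF a(1)] mult_1)
    then have "(\<alpha> + \<epsilon>) / s\<^sup>2 \<le> \<alpha>" using s by (simp add: norm_divide power_divide)
    then show "\<alpha> + \<epsilon> \<le> \<alpha> * s\<^sup>2" using s by (simp add: divide_le_eq)
  qed
qed

section \<open>Measures with at most three atoms\<close>
definition params :: "(complex \<times> complex \<times> complex \<times> real \<times> real \<times> real) set" where
  "params = {(w1,w2,w3,l1,l2,l3). cmod w1 = 1 \<and> cmod w2 = 1 \<and> cmod w3 = 1 \<and> 0 \<le> l1 \<and> 0 \<le> l2 \<and> 0 \<le> l3
     \<and> l1 + l2 + l3 = 1 \<and> of_real l1 * w1 + of_real l2 * w2 + of_real l3 * w3 = 0}"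

text \<open>A sum instead of nested conditionals, so that the masses of coinciding atoms
  add.\<close>

fun atomic :: "complex \<times> complex \<times> complex \<times> real \<times> real \<times> real \<Rightarrow> complex \<Rightarrow> real" where
  "atomic (w1,w2,w3,l1,l2,l3) = (\<lambda>w. (if w = w1 then l1 else 0) + (if w = w2 then l2 else 0) + (if w = w3 then l3 else 0))"

lemma mint_atomic:
  "mint (atomic (w1,w2,w3,l1,l2,l3)) f = of_real l1 * f w1 + of_real l2 * f w2 + of_real l3 * f w3"
proof -
  let ?S = "{w1,w2,w3}"
  have delta: "(\<Sum>w\<in>?S. of_real (if w = v then l else 0) * f w) = of_real l * f v" if "v \<in> ?S" for v l
  proof -
    have "(\<Sum>w\<in>?S. of_real (if w = v then l else 0) * f w) = (\<Sum>w\<in>?S. if w = v then of_real l * f v else 0)"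
      by (intro sum.cong) auto
    also have "\<dots> = of_real l * f v" using that by (subst sum.delta) auto
    finally show ?thesis .
  qed
  have "mint (atomic (w1,w2,w3,l1,l2,l3)) f = (\<Sum>w\<in>?S. of_real (atomic (w1,w2,w3,l1,l2,l3) w) * f w)"
    unfolding mint_def by (rule sum.mono_neutral_left) (auto simp: msupp_def split: if_splits)
  also have "\<dots> = (\<Sum>w\<in>?S. of_real (if w = w1 then l1 else 0) * f w)
      + (\<Sum>w\<in>?S. of_real (if w = w2 then l2 else 0) * f w) + (\<Sum>w\<in>?S. of_real (if w = w3 then l3 else 0) * f w)"
    unfolding sum.distrib[symmetric] by (intro sum.cong refl) (simp add: algebra_simps)
  finally show ?thesis using delta by simp
qed

text \<open>On the line through \<open>w1\<close> and \<open>w3\<close>, the condition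
  \<open>cmod w2 = 1\<close> reads \<open>u * (1 - u) * (cmod (w1 - w3))\<^sup>2 = 0\<close>, so a
  line meets the circle at most twice.\<close>

lemma not_collinear_circle:
  fixes w1 w2 w3 :: complex
  assumes "cmod w1 = 1" "cmod w2 = 1" "cmod w3 = 1" "w1 \<noteq> w2" "w1 \<noteq> w3" "w2 \<noteq> w3"
  shows "\<not> collinear {w1,w2,w3}"
proof
  assume "collinear {w1,w2,w3}"
  then obtain u where u: "w2 = u *\<^sub>R w1 + (1 - u) *\<^sub>R w3"
    using assms unfolding collinear_3_expand by blast
  have n: "w1 \<bullet> w1 = 1" "w2 \<bullet> w2 = 1" "w3 \<bullet> w3 = 1" using assms by (simp_all add: dot_square_norm)
  have "w2 \<bullet> w2 = u\<^sup>2 * (w1 \<bullet> w1) + (1-u)\<^sup>2 * (w3 \<bullet> w3) + 2 * u * (1-u) * (w1 \<bullet> w3)"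
    unfolding u by (simp add: inner_add_left inner_add_right inner_commute power2_eq_square algebra_simps)
  then have "u * (1-u) * (2 - 2 * (w1 \<bullet> w3)) = 0" unfolding n by (simp add: power2_eq_square algebra_simps)
  moreover have "2 - 2 * (w1 \<bullet> w3) = (w1 - w3) \<bullet> (w1 - w3)" using n by (simp add: inner_diff_left inner_diff_right inner_commute)
  then have "2 - 2 * (w1 \<bullet> w3) \<noteq> 0" using assms(5) by simp
  ultimately have "u = 0 \<or> u = 1" by simp
  then show False using u assms by auto
qed

lemma balanced_pair:
  fixes l m :: real and v w :: complex
  assumes "cmod v = 1" "cmod w = 1" "0 \<le> l" "0 \<le> m" "l + m = 1" "of_real l * v + of_real m * w = 0"
  shows "l = 1/2" "m = 1/2" "w = - v"
proof -
  have eq: "of_real l * v = - (of_real m * w)" using assms(6) by (simp add: add_eq_0_iff2)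
  then have "cmod (of_real l * v) = cmod (of_real m * w)" by simp
  then have "l = m" using assms by (simp add: norm_mult)
  then show "l = 1/2" "m = 1/2" using assms(5) by auto
  then have "complex_of_real l \<noteq> 0" "of_real l * v = of_real l * (- w)" using eq \<open>l = m\<close> by auto
  then have "v = - w" using mult_left_cancel by blast
  then show "w = - v" by simp
qed

text \<open>If a weight vanishes or two atoms coincide, at most two atoms remain, and balance makes
  them antipodal with equal mass. Otherwise the positive weights put 0 in the interior of a
  nondegenerate triangle.\<close>

lemma atomic_in_theta_hat:
  assumes "p \<in> params"
  shows "atomic p \<in> theta_hat"
proof -
  obtain w1 w2 w3 l1 l2 l3 where p: "p = (w1,w2,w3,l1,l2,l3)" by (cases p) auto
  have w: "cmod w1 = 1" "cmod w2 = 1" "cmod w3 = 1" and l: "0 \<le> l1" "0 \<le> l2" "0 \<le> l3" "l1 + l2 + l3 = 1"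
    and s: "of_real l1 * w1 + of_real l2 * w2 + of_real l3 * w3 = 0"
    using assms by (auto simp: p params_def)
  have pair: "\<mu> \<in> theta_hat" if "cmod v = 1" "cmod w = 1" "0 \<le> l" "0 \<le> m" "l + m = 1"
    "of_real l * v + of_real m * w = 0" "\<mu> = (\<lambda>x. (if x = v then l else 0) + (if x = w then m else 0))" for \<mu> v w l m
  proof -
    have "v \<noteq> - v" using that(1) by (metis add_eq_0_iff2 mult_2 mult_eq_0_iff norm_zero zero_neq_numeral zero_neq_one)
    then have "\<mu> = (\<lambda>x. if x = v \<or> x = - v then 1/2 else 0)"
      unfolding that(7) balanced_pair[OF that(1-6)] by (auto simp: fun_eq_iff)
    then show ?thesis using that(1) unfolding theta_hat_def by blast
  qed
  consider "l1 = 0 \<or> w1 = w2" | "l2 = 0 \<or> w2 = w3" | "l3 = 0 \<or> w1 = w3" |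
      "l1 > 0 \<and> l2 > 0 \<and> l3 > 0 \<and> w1 \<noteq> w2 \<and> w1 \<noteq> w3 \<and> w2 \<noteq> w3"
    using l by fastforce
  then show ?thesis
  proof cases
    case 1
    show ?thesis by (rule pair[of w2 w3 "l1 + l2" l3]) (use 1 w l s in \<open>auto simp: p fun_eq_iff algebra_simps\<close>)
  next
    case 2
    show ?thesis by (rule pair[of w1 w3 l1 "l2 + l3"]) (use 2 w l s in \<open>auto simp: p fun_eq_iff algebra_simps\<close>)
  next
    case 3
    show ?thesis by (rule pair[of w1 w2 "l1 + l3" l2]) (use 3 w l s in \<open>auto simp: p fun_eq_iff algebra_simps\<close>)
  next
    case 4
    have "0 \<in> interior (convex hull {w1,w2,w3})"
    proof -
      have "\<not> collinear {w1,w2,w3}" using 4 w by (intro not_collinear_circle) auto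
      then have "interior (convex hull {w1,w2,w3})
          = {v. \<exists>x y z. 0 < x \<and> 0 < y \<and> 0 < z \<and> x + y + z = 1 \<and> x *\<^sub>R w1 + y *\<^sub>R w2 + z *\<^sub>R w3 = v}"
        by (intro interior_convex_hull_3_minimal) auto
      moreover have "l1 *\<^sub>R w1 + l2 *\<^sub>R w2 + l3 *\<^sub>R w3 = 0" using s by (simp add: scaleR_conv_of_real)
      ultimately show ?thesis using 4 l by blast
    qed
    moreover have "atomic p = (\<lambda>w. if w = w1 then l1 else if w = w2 then l2 else if w = w3 then l3 else 0)"
      using 4 by (auto simp: p fun_eq_iff)
    ultimately show ?thesis using 4 w l s unfolding theta_hat_def by blast
  qed
qed

lemma theta_hat_atomic:
  assumes "\<mu> \<in> theta_hat"
  obtains p where "p \<in> params" "\<mu> = atomic p"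
proof -
  consider (pair) a where "cmod a = 1" "\<mu> = (\<lambda>w. if w = a \<or> w = -a then 1/2 else 0)"
    | (triple) w1 w2 w3 l1 l2 l3 where "cmod w1 = 1" "cmod w2 = 1" "cmod w3 = 1"
             "w1 \<noteq> w2" "w1 \<noteq> w3" "w2 \<noteq> w3"
             "0 \<in> interior (convex hull {w1, w2, w3})"
             "l1 + l2 + l3 = 1"
             "of_real l1 * w1 + of_real l2 * w2 + of_real l3 * w3 = 0"
             "\<mu> = (\<lambda>w. if w = w1 then l1 else if w = w2 then l2 else if w = w3 then l3 else 0)"
    using assms unfolding theta_hat_def by blast
  then show ?thesis
  proof cases
    case pair
    then have "a \<noteq> - a" by (metis add_eq_0_iff2 mult_2 mult_eq_0_iff norm_zero zero_neq_numeral zero_neq_one)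
    \<comment> \<open>The third atom is a dummy of weight 0; any point of the circle would
      do.\<close>
    then have "\<mu> = atomic (a, -a, 1, 1/2, 1/2, 0)" using pair by (auto simp: fun_eq_iff)
    moreover have "(a, -a, 1, 1/2, 1/2, 0) \<in> params" using pair by (auto simp: params_def)
    ultimately show ?thesis using that by blast
  next
    case triple
    have nc: "\<not> collinear {w1,w2,w3}" using triple by (intro not_collinear_circle)
    have "0 \<in> convex hull {w1,w2,w3}" using triple(7) interior_subset by blast
    then obtain x y z where xyz: "0 \<le> x" "0 \<le> y" "0 \<le> z" "x + y + z = 1" "x *\<^sub>R w1 + y *\<^sub>R w2 + z *\<^sub>R w3 = 0"
      unfolding convex_hull_3 by force
    have l: "l1 *\<^sub>R w1 + l2 *\<^sub>R w2 + l3 *\<^sub>R w3 = 0" using triple(9) by (simp add: scaleR_conv_of_real)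
    \<comment> \<open>Uniqueness of barycentric coordinates transfers nonnegativity from the
      coordinates given by the hull: a nonzero difference would make the atoms collinear.\<close>
    define d1 d2 where "d1 = l1 - x" and "d2 = l2 - y"
    have "(l1 *\<^sub>R w1 + l2 *\<^sub>R w2 + l3 *\<^sub>R w3) - (x *\<^sub>R w1 + y *\<^sub>R w2 + z *\<^sub>R w3) = d1 *\<^sub>R (w1 - w3) + d2 *\<^sub>R (w2 - w3)"
    proof -
      have "l3 = 1 - l1 - l2" "z = 1 - x - y" using triple(8) xyz(4) by auto
      then show ?thesis unfolding d1_def d2_def by (simp only:) (simp add: algebra_simps)
    qed
    then have dd: "d1 *\<^sub>R (w1 - w3) + d2 *\<^sub>R (w2 - w3) = 0" using l xyz(5) by simp
    have "d2 = 0"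
    proof (rule ccontr)
      assume "d2 \<noteq> 0"
      define u where "u = - (d1 / d2)"
      have "d2 *\<^sub>R (w2 - w3) = d2 *\<^sub>R (u *\<^sub>R (w1 - w3))"
        using dd \<open>d2 \<noteq> 0\<close> by (simp add: u_def add_eq_0_iff)
      then have "w2 - w3 = u *\<^sub>R (w1 - w3)" using \<open>d2 \<noteq> 0\<close> scaleR_left_imp_eq by blast
      then have "w2 = u *\<^sub>R w1 + (1 - u) *\<^sub>R w3" by (simp add: algebra_simps)
      then show False using nc unfolding collinear_3_expand by blast
    qed
    moreover from this have "d1 = 0" using dd triple(5) by simp
    ultimately have "l1 = x" "l2 = y" by (auto simp: d1_def d2_def)
    then have "0 \<le> l1" "0 \<le> l2" "0 \<le> l3" using xyz triple(8) by auto
    then have "(w1,w2,w3,l1,l2,l3) \<in> params" using triple by (simp add: params_def)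
    moreover have "\<mu> = atomic (w1,w2,w3,l1,l2,l3)" using triple by (auto simp: fun_eq_iff)
    ultimately show ?thesis using that by blast
  qed
qed

lemma compact_params: "compact params"
proof -
  let ?S = "sphere (0::complex) 1 \<times> sphere (0::complex) 1 \<times> sphere (0::complex) 1 \<times> {0..1::real} \<times> {0..1::real} \<times> {0..1::real}"
  let ?l = "\<lambda>p::complex \<times> complex \<times> complex \<times> real \<times> real \<times> real.
    fst (snd (snd (snd p))) + fst (snd (snd (snd (snd p)))) + snd (snd (snd (snd (snd p))))"
  let ?s = "\<lambda>p::complex \<times> complex \<times> complex \<times> real \<times> real \<times> real.
    of_real (fst (snd (snd (snd p)))) * fst p + of_real (fst (snd (snd (snd (snd p))))) * fst (snd p)
    + of_real (snd (snd (snd (snd (snd p))))) * fst (snd (snd p))"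
  have eq: "params = ?S \<inter> ({p. ?l p = 1} \<inter> {p. ?s p = 0})" by (auto simp: params_def)
  show ?thesis unfolding eq
  proof (rule compact_Int_closed)
    show "compact ?S" by (intro compact_Times compact_sphere compact_Icc)
    show "closed ({p. ?l p = 1} \<inter> {p. ?s p = 0})"
      by (intro closed_Int closed_Collect_eq continuous_intros)
  qed
qed

text \<open>Integrals of continuous functions depend continuously on atoms and weights. Weak-*
  closed sets therefore pull back to closed, hence compact, sets of parameters.\<close>

lemma continuous_atomic: "continuous_map (top_of_set params) weak_star_theta atomic"
  unfolding weak_star_theta_def
proof (rule continuous_on_generated_topo)
  fix V assume "V \<in> {{\<mu> \<in> theta_hat. mint \<mu> f \<in> U} | f U. continuous_on (sphere 0 1) f \<and> open U}"
  then obtain f U where V: "V = {\<mu> \<in> theta_hat. mint \<mu> f \<in> U}" and f: "continuous_on (sphere 0 1) f" and U: "open U" by blast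
  let ?m = "\<lambda>p::complex \<times> complex \<times> complex \<times> real \<times> real \<times> real.
    of_real (fst (snd (snd (snd p)))) * f (fst p) + of_real (fst (snd (snd (snd (snd p))))) * f (fst (snd p))
    + of_real (snd (snd (snd (snd (snd p))))) * f (fst (snd (snd p)))"
  have m: "mint (atomic p) f = ?m p" for p by (cases p) (simp add: mint_atomic del: atomic.simps)
  have "continuous_on params ?m"
    by (intro continuous_intros continuous_on_compose2[OF f]) (auto simp: params_def)
  moreover have "atomic -` V \<inter> topspace (top_of_set params) = params \<inter> ?m -` U"
    using atomic_in_theta_hat by (auto simp: V m)
  ultimately show "openin (top_of_set params) (atomic -` V \<inter> topspace (top_of_set params))"
    using continuous_openin_preimage_gen[OF _ U] by simp
next
  let ?G = "{{\<mu> \<in> theta_hat. mint \<mu> f \<in> U} | f U. continuous_on (sphere 0 1) f \<and> open U}"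
  \<comment> \<open>The generating sets must cover the range of \<open>atomic\<close>; this trivial
    one is all of \<open>theta_hat\<close>.\<close>
  have "theta_hat = {\<mu> \<in> theta_hat. mint \<mu> (\<lambda>_. 0) \<in> UNIV}" by auto
  then have "theta_hat \<in> ?G" using continuous_on_const open_UNIV by blast
  then have "theta_hat \<subseteq> \<Union>?G" by (rule Union_upper)
  moreover have "atomic ` topspace (top_of_set params) \<subseteq> theta_hat"
    using atomic_in_theta_hat by (auto simp del: atomic.simps)
  ultimately show "atomic ` topspace (top_of_set params) \<subseteq> \<Union>?G" by (rule order_trans[rotated])
qed

section \<open>From atoms to Blaschke products\<close>

text \<open>For an antipodal pair the value depends on the weightless third atom, but it has modulus
  1 and so still stands for \<open>z\<^sup>2\<close>.\<close>

fun atom_sum :: "complex \<times> complex \<times> complex \<times> real \<times> real \<times> real \<Rightarrow> complex" where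
  "atom_sum (w1,w2,w3,l1,l2,l3) = w1 + w2 + w3"

text \<open>Both follow by conjugation, since \<open>cnj w\<close> is the inverse of
  \<open>w\<close> on the circle.\<close>

lemma params_symmetric:
  assumes "(w1,w2,w3,l1,l2,l3) \<in> params"
  shows "of_real l1 * (w2 * w3) + of_real l2 * (w1 * w3) + of_real l3 * (w1 * w2) = 0"
    and "w1 * w2 + w1 * w3 + w2 * w3 = w1 * w2 * w3 * cnj (w1 + w2 + w3)"
proof -
  have w: "w1 * cnj w1 = 1" "w2 * cnj w2 = 1" "w3 * cnj w3 = 1"
    using assms by (auto simp: params_def complex_norm_square[symmetric])
  have "cnj (of_real l1 * w1 + of_real l2 * w2 + of_real l3 * w3) = 0"
    using assms by (simp add: params_def)
  then have s: "of_real l1 * cnj w1 + of_real l2 * cnj w2 + of_real l3 * cnj w3 = 0" by simp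
  have "of_real l1 * (w2 * w3) + of_real l2 * (w1 * w3) + of_real l3 * (w1 * w2)
    = of_real l1 * (w2 * w3) * (w1 * cnj w1) + of_real l2 * (w1 * w3) * (w2 * cnj w2)
      + of_real l3 * (w1 * w2) * (w3 * cnj w3)" unfolding w by simp
  also have "\<dots> = w1 * w2 * w3 * (of_real l1 * cnj w1 + of_real l2 * cnj w2 + of_real l3 * cnj w3)"
    by (simp add: algebra_simps)
  finally show "of_real l1 * (w2 * w3) + of_real l2 * (w1 * w3) + of_real l3 * (w1 * w2) = 0"
    unfolding s by simp
  have "w1 * w2 + w1 * w3 + w2 * w3 = w1 * w2 * (w3 * cnj w3) + w1 * w3 * (w2 * cnj w2) + w2 * w3 * (w1 * cnj w1)"
    unfolding w by simp
  then show "w1 * w2 + w1 * w3 + w2 * w3 = w1 * w2 * w3 * cnj (w1 + w2 + w3)"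
    by (simp add: algebra_simps)
qed

text \<open>The second elementary symmetric function has the same modulus as the sum, and balance
  identifies it with minus the weighted mean of the squares of the atoms.\<close>

lemma norm_atom_sum_le_1:
  assumes "p \<in> params"
  shows "cmod (atom_sum p) \<le> 1"
proof -
  obtain w1 w2 w3 l1 l2 l3 where p: "p = (w1,w2,w3,l1,l2,l3)" by (cases p) auto
  note p_in = assms[unfolded p]
  have w: "cmod w1 = 1" "cmod w2 = 1" "cmod w3 = 1" and l: "0 \<le> l1" "0 \<le> l2" "0 \<le> l3" "l1 + l2 + l3 = 1"
    and s: "of_real l1 * w1 + of_real l2 * w2 + of_real l3 * w3 = 0"
    using p_in by (auto simp: params_def)
  let ?e2 = "w1 * w2 + w1 * w3 + w2 * w3"
  have "of_real l1 * w1\<^sup>2 + of_real l2 * w2\<^sup>2 + of_real l3 * w3\<^sup>2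
    = (w1 + w2 + w3) * (of_real l1 * w1 + of_real l2 * w2 + of_real l3 * w3)
      - of_real (l1 + l2 + l3) * ?e2
      + (of_real l1 * (w2 * w3) + of_real l2 * (w1 * w3) + of_real l3 * (w1 * w2))"
    by (simp add: algebra_simps power2_eq_square)
  also have "\<dots> = - ?e2" unfolding s l(4) params_symmetric(1)[OF p_in] by simp
  finally have "cmod ?e2 = cmod (of_real l1 * w1\<^sup>2 + of_real l2 * w2\<^sup>2 + of_real l3 * w3\<^sup>2)"
    by (simp only: norm_minus_cancel)
  also have "\<dots> \<le> cmod (of_real l1 * w1\<^sup>2) + cmod (of_real l2 * w2\<^sup>2) + cmod (of_real l3 * w3\<^sup>2)"
    by (intro norm_triangle_le add_right_mono norm_triangle_ineq) auto
  also have "\<dots> = 1" using l by (simp add: norm_mult norm_power w)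
  finally have "cmod ?e2 \<le> 1" .
  moreover have "cmod ?e2 = cmod (w1 + w2 + w3)"
    unfolding params_symmetric(2)[OF p_in] norm_mult complex_mod_cnj by (simp add: w)
  ultimately show ?thesis by (simp add: p)
qed

text \<open>With \<open>S\<close> the weighted sum of the \<open>1 / (w - z)\<close>, the function
  is \<open>z * S / (1 + z * S)\<close>. After multiplication by \<open>D\<close> the balance
  relations collapse the numerator to \<open>z\<^sup>2 * (z - b)\<close> and the denominator to
  \<open>w1 * w2 * w3 * (1 - cnj b * z)\<close>.\<close>

lemma psi_theta_atomic:
  assumes "p \<in> params"
  obtains c where "cmod c = 1" "\<And>z. z \<in> ball 0 1 \<Longrightarrow> psi_theta (atomic p) z = c * blaschke2 (atom_sum p) z"
proof -
  obtain w1 w2 w3 l1 l2 l3 where p: "p = (w1,w2,w3,l1,l2,l3)" by (cases p) auto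
  note p_in = assms[unfolded p]
  have w: "cmod w1 = 1" "cmod w2 = 1" "cmod w3 = 1" and l: "l1 + l2 + l3 = 1"
    and s: "of_real l1 * w1 + of_real l2 * w2 + of_real l3 * w3 = 0"
    using p_in by (auto simp: params_def)
  define b where "b = w1 + w2 + w3"
  have b: "cmod b \<le> 1" using norm_atom_sum_le_1[OF assms] by (simp add: p b_def)
  have "psi_theta (atomic p) z = inverse (w1 * w2 * w3) * blaschke2 b z" if "z \<in> ball 0 1" for z
  proof -
    define a1 a2 a3 where "a1 = 1 / (w1 - z)" and "a2 = 1 / (w2 - z)" and "a3 = 1 / (w3 - z)"
    define D where "D = (w1 - z) * (w2 - z) * (w3 - z)"
    have nz: "w1 - z \<noteq> 0" "w2 - z \<noteq> 0" "w3 - z \<noteq> 0" using w that by auto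
    define S where "S = of_real l1 * a1 + of_real l2 * a2 + of_real l3 * a3"
    have a: "(w1 + z) / (w1 - z) = 1 + 2 * z * a1" "(w2 + z) / (w2 - z) = 1 + 2 * z * a2" "(w3 + z) / (w3 - z) = 1 + 2 * z * a3"
      using nz by (simp_all add: a1_def a2_def a3_def field_simps)
    have "herglotz (atomic p) z = of_real (l1 + l2 + l3) + 2 * z * S"
      unfolding herglotz_def p mint_atomic a S_def by (simp add: algebra_simps)
    then have "herglotz (atomic p) z - 1 = 2 * (z * S)" "herglotz (atomic p) z + 1 = 2 * (1 + z * S)"
      using l by simp_all
    then have psi: "psi_theta (atomic p) z = (z * S) / (1 + z * S)"
      unfolding psi_theta_def by (simp only: mult_divide_mult_cancel_left[OF zero_neq_numeral[symmetric]])
    have DS: "D * S = of_real l1 * ((w2 - z) * (w3 - z)) + of_real l2 * ((w1 - z) * (w3 - z)) + of_real l3 * ((w1 - z) * (w2 - z))"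
    proof -
      have "(w1 - z) * a1 = 1" "(w2 - z) * a2 = 1" "(w3 - z) * a3 = 1"
        using nz by (simp_all add: a1_def a2_def a3_def)
      moreover have "D * S = of_real l1 * ((w2 - z) * (w3 - z)) * ((w1 - z) * a1)
          + of_real l2 * ((w1 - z) * (w3 - z)) * ((w2 - z) * a2) + of_real l3 * ((w1 - z) * (w2 - z)) * ((w3 - z) * a3)"
        unfolding D_def S_def by (simp add: algebra_simps)
      ultimately show ?thesis by (simp only: mult_1_right)
    qed
    also have "\<dots> = (of_real l1 * (w2 * w3) + of_real l2 * (w1 * w3) + of_real l3 * (w1 * w2))
        - z * (of_real (l1 + l2 + l3) * b - (of_real l1 * w1 + of_real l2 * w2 + of_real l3 * w3))
        + of_real (l1 + l2 + l3) * z\<^sup>2"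
      by (simp add: b_def algebra_simps power2_eq_square)
    also have "\<dots> = z * (z - b)"
      unfolding s l params_symmetric(1)[OF p_in] by (simp add: algebra_simps power2_eq_square)
    finally have DS: "D * S = z * (z - b)" .
    have "D * (1 + z * S) = D + z * (D * S)" by (simp add: algebra_simps)
    also have "\<dots> = w1 * w2 * w3 - (w1 * w2 + w1 * w3 + w2 * w3) * z"
      unfolding DS by (simp add: D_def b_def algebra_simps)
    also have "\<dots> = w1 * w2 * w3 * (1 - cnj b * z)"
      unfolding params_symmetric(2)[OF p_in] b_def[symmetric] by (simp add: algebra_simps)
    finally have D1: "D * (1 + z * S) = w1 * w2 * w3 * (1 - cnj b * z)" .
    have "D \<noteq> 0" using nz by (simp add: D_def)
    then have "psi_theta (atomic p) z = (D * (z * S)) / (D * (1 + z * S))"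
      unfolding psi by simp
    also have "D * (z * S) = z\<^sup>2 * (z - b)" using DS by (simp add: power2_eq_square mult.left_commute)
    finally show ?thesis unfolding D1 blaschke2_def by (simp add: field_simps)
  qed
  moreover have "cmod (inverse (w1 * w2 * w3)) = 1" by (simp add: norm_inverse norm_mult w)
  ultimately show ?thesis using that by (simp add: p b_def)
qed

lemma continuous_on_atom_sum: "continuous_on S atom_sum"
proof -
  have eq: "atom_sum = (\<lambda>p. fst p + fst (snd p) + fst (snd (snd p)))" by (auto simp: fun_eq_iff)
  show ?thesis unfolding eq by (intro continuous_intros)
qed

lemma at_minus_one_ball_neq_bot: "at (-1::complex) within ball 0 1 \<noteq> bot"
  by (simp add: trivial_limit_within islimpt_ball)

text \<open>The normalisation at \<open>-1\<close> cancels the unknown constant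
  \<open>c\<close>.\<close>

lemma Phi_atomic:
  assumes p: "p \<in> params" and l: "cmod l = 1" "(blaschke2 (atom_sum p) \<longlongrightarrow> l) (at (-1) within ball 0 1)"
  shows "Phi (atomic p) = (\<lambda>z. if z \<in> ball 0 1 then cnj l * blaschke2 (atom_sum p) z else 0)"
proof -
  obtain c where c: "cmod c = 1" "\<And>z. z \<in> ball 0 1 \<Longrightarrow> psi_theta (atomic p) z = c * blaschke2 (atom_sum p) z"
    using psi_theta_atomic[OF p] by blast
  have "((\<lambda>z. c * blaschke2 (atom_sum p) z) \<longlongrightarrow> c * l) (at (-1) within ball 0 1)"
    by (intro tendsto_intros l)
  then have "(psi_theta (atomic p) \<longlongrightarrow> c * l) (at (-1) within ball 0 1)"
    by (rule Lim_transform_eventually)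
      (use c(2) in \<open>auto simp: eventually_at_filter\<close>)
  then have "psi_at_m1 (atomic p) = c * l"
    unfolding psi_at_m1_def by (rule tendsto_Lim[OF at_minus_one_ball_neq_bot])
  moreover have "cnj (c * l) * (c * x) = cnj l * x" for x
  proof -
    have "cnj (c * l) * (c * x) = (c * cnj c) * (cnj l * x)" by simp
    then show ?thesis using c(1) by (simp add: complex_norm_square[symmetric])
  qed
  ultimately show ?thesis using c(2) by (auto simp: Phi_def fun_eq_iff)
qed

lemma Phi_atomic_unimodular_multiple:
  assumes "p \<in> params"
  obtains c where "cmod c = 1" "\<And>z. z \<in> ball 0 1 \<Longrightarrow> Phi (atomic p) z = c * blaschke2 (atom_sum p) z"
proof -
  obtain l where "cmod l = 1" "(blaschke2 (atom_sum p) \<longlongrightarrow> l) (at (-1) within ball 0 1)"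
    using blaschke2_limit[OF norm_atom_sum_le_1[OF assms]] by blast
  then show ?thesis using that[of "cnj l"] Phi_atomic[OF assms] by simp
qed

text \<open>For unimodular sums the boundary value \<open>- b\<close> cancels the factor of
  \<open>- b * z\<^sup>2\<close>, leaving \<open>z\<^sup>2\<close> on both sides.\<close>

lemma Phi_atomic_eq:
  assumes "p \<in> params" "q \<in> params" "atom_sum p = atom_sum q \<or> cmod (atom_sum p) = 1 \<and> cmod (atom_sum q) = 1"
  shows "Phi (atomic p) = Phi (atomic q)"
proof -
  obtain l where l: "cmod l = 1" "(blaschke2 (atom_sum p) \<longlongrightarrow> l) (at (-1) within ball 0 1)" "cmod (atom_sum p) = 1 \<Longrightarrow> l = - atom_sum p"
    using blaschke2_limit[OF norm_atom_sum_le_1[OF assms(1)]] by blast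
  obtain m where m: "cmod m = 1" "(blaschke2 (atom_sum q) \<longlongrightarrow> m) (at (-1) within ball 0 1)" "cmod (atom_sum q) = 1 \<Longrightarrow> m = - atom_sum q"
    using blaschke2_limit[OF norm_atom_sum_le_1[OF assms(2)]] by blast
  note Phi = Phi_atomic[OF assms(1) l(1,2)] Phi_atomic[OF assms(2) m(1,2)]
  show ?thesis
  proof (cases "atom_sum p = atom_sum q")
    case True
    then have "l = m" using l(2) m(2) tendsto_unique[OF at_minus_one_ball_neq_bot] by metis
    show ?thesis unfolding Phi True \<open>l = m\<close> ..
  next
    case False
    then have 1: "cmod (atom_sum p) = 1" "cmod (atom_sum q) = 1" using assms(3) by auto
    have "cnj (- b) * blaschke2 b z = z\<^sup>2" if "cmod b = 1" "z \<in> ball 0 1" for b z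
    proof -
      have "cnj (- b) * blaschke2 b z = (b * cnj b) * z\<^sup>2" using that by (simp add: blaschke2_unimodular)
      then show ?thesis using that by (simp add: complex_norm_square[symmetric])
    qed
    then show ?thesis unfolding Phi l(3)[OF 1(1)] m(3)[OF 1(2)]
      using 1 by (simp add: fun_eq_iff del: complex_cnj_minus)
  qed
qed

section \<open>Minimality\<close>

lemma Hinf1_blaschke2:
  assumes b: "cmod b \<le> 1" and f: "\<And>z. z \<in> ball 0 1 \<Longrightarrow> f z = c * blaschke2 b z"
  shows "Hinf1 f"
  unfolding Hinf1_def
proof (intro conjI)
  have nz: "1 - cnj b * z \<noteq> 0" if "z \<in> ball 0 1" for z using blaschke2_denominator_nonzero[OF b, of z] that by simp
  have "(\<lambda>z. c * blaschke2 b z) holomorphic_on ball 0 1"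
    unfolding blaschke2_def using nz by (intro holomorphic_intros) auto
  then show "f holomorphic_on ball 0 1" using f holomorphic_cong by metis
  have "cmod (f z) \<le> cmod c" if "z \<in> ball 0 1" for z
    using f[OF that] norm_blaschke2_le_1[OF b, of z] that by (simp add: norm_mult mult_left_le)
  then show "bounded (f ` ball 0 1)" unfolding bounded_iff by blast
  have "((\<lambda>z. c * (z\<^sup>2 * (z - b) / (1 - cnj b * z))) has_field_derivative 0) (at 0)"
    by (auto intro!: derivative_eq_intros)
  then have "((\<lambda>z. c * blaschke2 b z) has_field_derivative 0) (at 0)" by (simp add: blaschke2_def)
  then have "(f has_field_derivative 0) (at 0)"
    by (rule has_field_derivative_transform_within_open[of _ _ _ "ball 0 1"]) (use f in auto)
  then show "deriv f 0 = 0" by (rule DERIV_imp_deriv)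
qed

text \<open>Shows that the infimum defining \<open>Hinf_K_norm\<close> is over a nonempty set. The
  complex scalar may be replaced by its modulus because only products \<open>f x * cnj (f y)\<close>
  enter.\<close>

lemma Hinf_K_imp_ball:
  assumes "Hinf_K C f"
  obtains t where "0 < t" "Hinf_K_ball C (\<lambda>z. f z / of_real t)"
proof -
  obtain c g where g: "Hinf_K_ball C g" and f: "\<And>z. z \<in> ball 0 1 \<Longrightarrow> f z = c * g z"
    using assms unfolding Hinf_K_def by blast
  show ?thesis
  proof (cases "c = 0")
    case True
    have "Hinf_K_ball C (\<lambda>z. f z / of_real 1)"
      unfolding Hinf_K_ball_def
    proof
      fix k assume "k \<in> K_set C"
      then have "psd_kernel k" by (simp add: K_set_def)
      then show "psd_kernel (\<lambda>x y. (1 - f x / of_real 1 * cnj (f y / of_real 1)) * k x y)"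
        by (subst psd_kernel_cong[of _ k]) (simp_all add: f True)
    qed
    then show ?thesis using that[of 1] by simp
  next
    case False
    have "Hinf_K_ball C (\<lambda>z. f z / of_real (cmod c))"
      unfolding Hinf_K_ball_def
    proof
      fix k assume "k \<in> K_set C"
      then have "psd_kernel (\<lambda>x y. (1 - g x * cnj (g y)) * k x y)" using g by (simp add: Hinf_K_ball_def)
      moreover have "f x / of_real (cmod c) * cnj (f y / of_real (cmod c)) = g x * cnj (g y)"
        if "x \<in> ball 0 1" "y \<in> ball 0 1" for x y
      proof -
        have "f x / of_real (cmod c) * cnj (f y / of_real (cmod c)) = (c * cnj c) / (of_real (cmod c))\<^sup>2 * (g x * cnj (g y))"
          using f that by (simp add: power2_eq_square)
        then show ?thesis using False by (simp add: complex_norm_square[symmetric])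
      qed
      ultimately show "psd_kernel (\<lambda>x y. (1 - f x / of_real (cmod c) * cnj (f y / of_real (cmod c))) * k x y)"
        by (subst psd_kernel_cong[of _ "\<lambda>x y. (1 - g x * cnj (g y)) * k x y"]) simp_all
    qed
    then show ?thesis using that[of "cmod c"] False by simp
  qed
qed

theorem mainTheorem9:
  fixes C :: "(complex \<Rightarrow> complex) set"
  assumes "C \<subseteq> Psi" and "C \<noteq> Psi" and "closed_in_Psi C"
  shows "\<not> test_functions_for_Hinf1 C"
proof
  assume test: "test_functions_for_Hinf1 C"
  obtain \<mu>0 where "\<mu>0 \<in> theta_hat" "Phi \<mu>0 \<notin> C" using assms(1,2) unfolding Psi_def by blast
  then obtain p0 where p0: "p0 \<in> params" and p0C: "Phi (atomic p0) \<notin> C" using theta_hat_atomic by metis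
  define f where "f = Phi (atomic p0)"
  define a where "a = atom_sum p0"
  have a: "cmod a \<le> 1" using norm_atom_sum_le_1[OF p0] by (simp add: a_def)
  obtain c where c: "cmod c = 1" "\<And>z. z \<in> ball 0 1 \<Longrightarrow> f z = c * blaschke2 a z"
    using Phi_atomic_unimodular_multiple[OF p0] unfolding f_def a_def by blast
  \<comment> \<open>The closedness of \<open>C\<close> enters only through the compactness of this
    set.\<close>
  define W where "W = {p \<in> params. Phi (atomic p) \<in> C}"
  have "closedin (top_of_set params) {p \<in> topspace (top_of_set params). atomic p \<in> {\<mu> \<in> theta_hat. Phi \<mu> \<in> C}}"
    by (rule closedin_continuous_map_preimage[OF continuous_atomic])
      (use assms(3) in \<open>simp add: closed_in_Psi_def\<close>)
  moreover have "{p \<in> topspace (top_of_set params). atomic p \<in> {\<mu> \<in> theta_hat. Phi \<mu> \<in> C}} = W"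
    using atomic_in_theta_hat by (auto simp: W_def simp del: atomic.simps)
  ultimately have "compact W" using closedin_compact[OF compact_params] by simp
  then have K: "compact (atom_sum ` W)" by (rule compact_continuous_image[OF continuous_on_atom_sum])
  have K1: "atom_sum ` W \<subseteq> cball 0 1" using norm_atom_sum_le_1 by (auto simp: W_def simp del: atom_sum.simps)
  \<comment> \<open>Otherwise \<open>Phi_atomic_eq\<close> would put the omitted function into
    \<open>C\<close>.\<close>
  have sep: "atom_sum p \<noteq> a" "cmod a < 1 \<or> cmod (atom_sum p) < 1" if "p \<in> W" for p
    using Phi_atomic_eq[OF p0, of p] p0C that norm_atom_sum_le_1[of p] a unfolding W_def a_def by fastforce+
  obtain k \<alpha> \<beta> where k: "psd_kernel k"
    "\<And>b. b \<in> atom_sum ` W \<Longrightarrow> psd_kernel (\<lambda>x y. (1 - blaschke2 b x * cnj (blaschke2 b y)) * k x y)"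
    "0 \<le> \<alpha>" "\<alpha> < \<beta>"
    "\<And>s. 0 < s \<Longrightarrow> psd_kernel (\<lambda>x y. (1 - (blaschke2 a x / of_real s) * cnj (blaschke2 a y / of_real s)) * k x y)
       \<Longrightarrow> \<beta> \<le> \<alpha> * s\<^sup>2"
  proof (rule separating_kernel[OF K K1 a])
    show "a \<notin> atom_sum ` W" using sep(1) by blast
    show "cmod a < 1 \<or> cmod b < 1" if "b \<in> atom_sum ` W" for b using sep(2) that by blast
  qed (use that in blast)
  have unimod: "(c * x) * cnj (c * y) = x * cnj y" if "cmod c = 1" for c x y
  proof -
    have "(c * x) * cnj (c * y) = (c * cnj c) * (x * cnj y)" by simp
    then show ?thesis using that by (simp add: complex_norm_square[symmetric])
  qed
  have "k \<in> K_set C"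
    unfolding K_set_def
  proof (intro CollectI conjI ballI k(1))
    fix \<psi> assume "\<psi> \<in> C"
    then obtain \<mu> where "\<mu> \<in> theta_hat" "\<psi> = Phi \<mu>" using assms(1) unfolding Psi_def by blast
    then obtain p where p: "p \<in> params" "\<psi> = Phi (atomic p)" using theta_hat_atomic by metis
    then have "atom_sum p \<in> atom_sum ` W" using \<open>\<psi> \<in> C\<close> by (simp add: W_def)
    obtain d where d: "cmod d = 1" "\<And>z. z \<in> ball 0 1 \<Longrightarrow> \<psi> z = d * blaschke2 (atom_sum p) z"
      using Phi_atomic_unimodular_multiple[OF p(1)] unfolding p(2) by blast
    have "psd_kernel (\<lambda>x y. (1 - \<psi> x * cnj (\<psi> y)) * k x y)
        \<longleftrightarrow> psd_kernel (\<lambda>x y. (1 - blaschke2 (atom_sum p) x * cnj (blaschke2 (atom_sum p) y)) * k x y)"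
      by (rule psd_kernel_cong) (simp only: d(2) unimod[OF d(1)])
    then show "psd_kernel (\<lambda>x y. (1 - \<psi> x * cnj (\<psi> y)) * k x y)"
      using k(2)[OF \<open>atom_sum p \<in> atom_sum ` W\<close>] by simp
  qed
  then have lower: "\<beta> \<le> \<alpha> * s\<^sup>2" if "0 < s" "Hinf_K_ball C (\<lambda>z. f z / of_real s)" for s
  proof -
    have "psd_kernel (\<lambda>x y. (1 - f x / of_real s * cnj (f y / of_real s)) * k x y)"
      using that(2) \<open>k \<in> K_set C\<close> unfolding Hinf_K_ball_def by blast
    moreover have "psd_kernel (\<lambda>x y. (1 - f x / of_real s * cnj (f y / of_real s)) * k x y)
      \<longleftrightarrow> psd_kernel (\<lambda>x y. (1 - blaschke2 a x / of_real s * cnj (blaschke2 a y / of_real s)) * k x y)"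
      by (rule psd_kernel_cong) (simp only: c(2) unimod[OF c(1)] times_divide_eq_right[symmetric])
    ultimately show ?thesis using k(5)[OF that(1)] by simp
  qed
  have H1: "Hinf1 f" by (rule Hinf1_blaschke2[OF a c(2)])
  then have HK: "Hinf_K C f" and norm: "Hinf_K_norm C f = sup_norm f"
    using test unfolding test_functions_for_Hinf1_def by auto
  obtain t where t: "0 < t" "Hinf_K_ball C (\<lambda>z. f z / of_real t)" using Hinf_K_imp_ball[OF HK] .
  \<comment> \<open>If \<open>\<alpha>\<close> were 0, an admissible \<open>t\<close> would force
    \<open>\<beta> \<le> 0\<close>. The ratio then bounds the norm below by a number above 1, while
    the sup norm is at most 1.\<close>
  have "0 < \<alpha>" using lower[OF t] k(3,4) by (cases "\<alpha> = 0") auto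
  then have "1 < sqrt (\<beta> / \<alpha>)" using k(4) by simp
  also have "sqrt (\<beta> / \<alpha>) \<le> Hinf_K_norm C f"
    unfolding Hinf_K_norm_def
  proof (rule cInf_greatest)
    show "{t. 0 < t \<and> Hinf_K_ball C (\<lambda>z. f z / of_real t)} \<noteq> {}" using t by blast
    fix s assume "s \<in> {t. 0 < t \<and> Hinf_K_ball C (\<lambda>z. f z / of_real t)}"
    then have "0 < s" "\<beta> \<le> \<alpha> * s\<^sup>2" using lower by auto
    then have "\<beta> / \<alpha> \<le> s\<^sup>2" using \<open>0 < \<alpha>\<close> by (simp add: divide_le_eq mult.commute)
    then show "sqrt (\<beta> / \<alpha>) \<le> s" using \<open>0 < s\<close> by (intro real_le_lsqrt) auto
  qed
  also have "\<dots> \<le> 1" unfolding norm sup_norm_def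
  proof (rule cSup_least)
    fix r assume "r \<in> (\<lambda>z. cmod (f z)) ` ball 0 1"
    then obtain z where z: "z \<in> ball 0 1" "r = cmod (f z)" by blast
    then show "r \<le> 1" using norm_blaschke2_le_1[OF a, of z] c(1) by (simp add: c(2) norm_mult)
  qed simp
  finally show False by simp
qed

end
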